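(* Let $G$ be a non-Dedekind infinite periodic group. Then $G$ is a locally nilpotent FCI-group if and only if $G=P\times Q$, where $P$ and $Q$ are as follows: (i) $P=\langle g, A\rangle$ is a $2$-group, where $A$ is infinite abelian of finite rank, and $g$ is an element of order at most $4$ such that $g^2\in A$ and $a^g=a^{-1}$ for all $a\in A$. (ii) $Q$ is a finite abelian $2'$-group.
   Context: A group $G$ is an FCI-group if $|C_G(x):\langle x\rangle|<\infty$ for every $x\in G$ such that $\langle x\rangle$ is not normal in $G$. A Dedekind group is a group all of whose subgroups are normal. A $2'$-group is a periodic group all of whose elements have odd order. The rank of an abelian $p$-group $A$ is the dimension, as a vector space over the field with $p$ elements, of the subgroup formed by the elements of order at most $p$. Notation: $a^g=g^{-1}ag$. *)

theory Defs
  imports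
    "HOL-Algebra.Multiplicative_Group"
    "HOL-Algebra.Generated_Groups"
    "HOL-Number_Theory.Residues"
    "Jordan_Normal_Form.Missing_VectorSpace"
begin

definition centralizer :: "('a, 'b) monoid_scheme \<Rightarrow> 'a \<Rightarrow> 'a set" where
  "centralizer G x = {y \<in> carrier G. y \<otimes>\<^bsub>G\<^esub> x = x \<otimes>\<^bsub>G\<^esub> y}"

text \<open>Finiteness of the index is finiteness of the set of cosets; \<^const>\<open>card\<close> cannot be used,
  being \<open>0\<close> on infinite sets.\<close>

definition finite_index :: "('a, 'b) monoid_scheme \<Rightarrow> 'a set \<Rightarrow> bool" where
  "finite_index G H \<longleftrightarrow> finite (rcosets\<^bsub>G\<^esub> H)"

definition FCI_group :: "('a, 'b) monoid_scheme \<Rightarrow> bool" where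
  "FCI_group G \<longleftrightarrow> group G \<and>
     (\<forall>x\<in>carrier G. \<not> generate G {x} \<lhd> G \<longrightarrow>
        finite_index (G\<lparr>carrier := centralizer G x\<rparr>) (generate G {x}))"

definition Dedekind_group :: "('a, 'b) monoid_scheme \<Rightarrow> bool" where
  "Dedekind_group G \<longleftrightarrow> group G \<and> (\<forall>H. subgroup H G \<longrightarrow> H \<lhd> G)"

text \<open>\<^const>\<open>group.ord\<close> is \<open>0\<close> on elements of infinite order.\<close>

definition periodic_group :: "('a, 'b) monoid_scheme \<Rightarrow> bool" where
  "periodic_group G \<longleftrightarrow> group G \<and> (\<forall>x\<in>carrier G. group.ord G x \<noteq> 0)"

definition p_group :: "nat \<Rightarrow> ('a, 'b) monoid_scheme \<Rightarrow> bool" where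
  "p_group p G \<longleftrightarrow> group G \<and> (\<forall>x\<in>carrier G. \<exists>k. group.ord G x = p ^ k)"

definition odd_order_group :: "('a, 'b) monoid_scheme \<Rightarrow> bool" where
  "odd_order_group G \<longleftrightarrow> periodic_group G \<and> (\<forall>x\<in>carrier G. odd (group.ord G x))"

definition commutator_subgroup ::
    "('a, 'b) monoid_scheme \<Rightarrow> 'a set \<Rightarrow> 'a set \<Rightarrow> 'a set" where
  "commutator_subgroup G H K =
     generate G {inv\<^bsub>G\<^esub> x \<otimes>\<^bsub>G\<^esub> inv\<^bsub>G\<^esub> y \<otimes>\<^bsub>G\<^esub> x \<otimes>\<^bsub>G\<^esub> y | x y. x \<in> H \<and> y \<in> K}"

primrec lower_central :: "('a, 'b) monoid_scheme \<Rightarrow> nat \<Rightarrow> 'a set" where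
  "lower_central G 0 = carrier G"
| "lower_central G (Suc n) = commutator_subgroup G (lower_central G n) (carrier G)"

definition nilpotent_group :: "('a, 'b) monoid_scheme \<Rightarrow> bool" where
  "nilpotent_group G \<longleftrightarrow> group G \<and> (\<exists>n. lower_central G n = {\<one>\<^bsub>G\<^esub>})"

definition locally_nilpotent_group :: "('a, 'b) monoid_scheme \<Rightarrow> bool" where
  "locally_nilpotent_group G \<longleftrightarrow> group G \<and>
     (\<forall>S. finite S \<and> S \<subseteq> carrier G \<longrightarrow> nilpotent_group (G\<lparr>carrier := generate G S\<rparr>))"

text \<open>For an abelian \<open>p\<close>-group \<open>A\<close>, the elements of order at most \<open>p\<close>, written additively and
  with scalars acting by powers.  The multiplicative fields of the record play no role.\<close>

definition omega_module :: "nat \<Rightarrow> ('a, 'b) monoid_scheme \<Rightarrow> (int, 'a) module" where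
  "omega_module p A =
     \<lparr>carrier = {x \<in> carrier A. group.ord A x \<noteq> 0 \<and> group.ord A x \<le> p},
      monoid.mult = (\<otimes>\<^bsub>A\<^esub>), one = \<one>\<^bsub>A\<^esub>,
      zero = \<one>\<^bsub>A\<^esub>, add = (\<otimes>\<^bsub>A\<^esub>),
      smult = (\<lambda>k x. x [^]\<^bsub>A\<^esub> k)\<rparr>"

text \<open>The hypotheses under which \<open>vectorspace.fin_dim\<close> below has its intended meaning.\<close>

lemma vectorspace_omega_module:
  assumes "prime p" "comm_group A" "p_group p A"
  shows "vectorspace (residue_ring (int p)) (omega_module p A)"
proof -
  interpret A: comm_group A by fact
  interpret R: residues_prime p "residue_ring (int p)"
    using assms(1) by unfold_locales auto
  have p1: "1 < p" using assms(1) by (rule prime_gt_1_nat)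
  have carr: "carrier (omega_module p A) = {x \<in> carrier A. x [^]\<^bsub>A\<^esub> p = \<one>\<^bsub>A\<^esub>}"
  proof -
    have "A.ord x \<noteq> 0 \<and> A.ord x \<le> p \<longleftrightarrow> A.ord x dvd p" if x: "x \<in> carrier A" for x
    proof -
      obtain k where k: "A.ord x = p ^ k"
        using assms(3) x by (auto simp: p_group_def)
      have "p ^ k \<le> p \<longleftrightarrow> k \<le> 1"
        using p1 power_increasing_iff[of p k 1] by simp
      moreover have "p ^ k dvd p \<longleftrightarrow> k \<le> 1"
        using p1 dvd_power_iff[of p k 1] by auto
      ultimately show ?thesis using k p1 by simp
    qed
    then show ?thesis unfolding omega_module_def partial_object.simps
      by (intro Collect_cong conj_cong refl) (simp add: A.pow_eq_id)
  qed
  have mod: "x [^]\<^bsub>A\<^esub> (k mod int p) = x [^]\<^bsub>A\<^esub> k"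
    if "x \<in> carrier A" "x [^]\<^bsub>A\<^esub> p = \<one>\<^bsub>A\<^esub>" for x k
  proof -
    have "x [^]\<^bsub>A\<^esub> k = x [^]\<^bsub>A\<^esub> (int p * (k div int p) + k mod int p)" by simp
    also have "\<dots> = (x [^]\<^bsub>A\<^esub> int p) [^]\<^bsub>A\<^esub> (k div int p) \<otimes>\<^bsub>A\<^esub> x [^]\<^bsub>A\<^esub> (k mod int p)"
      using that(1) by (simp only: A.int_pow_mult A.int_pow_pow)
    also have "\<dots> = x [^]\<^bsub>A\<^esub> (k mod int p)"
      using that by (simp add: int_pow_int)
    finally show ?thesis by simp
  qed
  have pow: "(x [^]\<^bsub>A\<^esub> k) [^]\<^bsub>A\<^esub> p = \<one>\<^bsub>A\<^esub>"
    if "x \<in> carrier A" "x [^]\<^bsub>A\<^esub> p = \<one>\<^bsub>A\<^esub>" for x and k :: int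
  proof -
    have "(x [^]\<^bsub>A\<^esub> k) [^]\<^bsub>A\<^esub> int p = (x [^]\<^bsub>A\<^esub> int p) [^]\<^bsub>A\<^esub> k"
      using that by (simp add: A.int_pow_pow mult.commute)
    then show ?thesis using that by (simp add: int_pow_int)
  qed
  have negc: "\<exists>w. w \<in> carrier A \<and> w [^]\<^bsub>A\<^esub> p = \<one>\<^bsub>A\<^esub> \<and> v \<otimes>\<^bsub>A\<^esub> w = \<one>\<^bsub>A\<^esub>"
    if "v \<in> carrier A" "v [^]\<^bsub>A\<^esub> p = \<one>\<^bsub>A\<^esub>" for v
    using that by (intro exI[of _ "inv\<^bsub>A\<^esub> v"]) (simp add: A.nat_pow_inv)
  have ops: "\<zero>\<^bsub>omega_module p A\<^esub> = \<one>\<^bsub>A\<^esub>" "add (omega_module p A) = (\<otimes>\<^bsub>A\<^esub>)"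
    "smult (omega_module p A) = (\<lambda>k x. x [^]\<^bsub>A\<^esub> k)"
    by (simp_all add: omega_module_def)
  show ?thesis
    using negc
    by (intro vs_criteria R.field_axioms)
      (auto simp: carr ops residue_ring_def mod pow A.pow_mult_distrib A.m_ac
        A.int_pow_mult A.int_pow_pow A.int_pow_distrib mult.commute Bex_def)
qed

definition finite_rank :: "nat \<Rightarrow> ('a, 'b) monoid_scheme \<Rightarrow> bool" where
  "finite_rank p A \<longleftrightarrow> vectorspace.fin_dim (residue_ring (int p)) (omega_module p A)"

definition internal_direct_product ::
    "('a, 'b) monoid_scheme \<Rightarrow> 'a set \<Rightarrow> 'a set \<Rightarrow> bool" where
  "internal_direct_product G P Q \<longleftrightarrow>
     P \<lhd> G \<and> Q \<lhd> G \<and> P \<inter> Q = {\<one>\<^bsub>G\<^esub>} \<and> P <#>\<^bsub>G\<^esub> Q = carrier G"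

end

theory Submission
  imports Defs
begin

text \<open>Let \<open>D\<close> be the set of elements that generate normal subgroups.  In an infinite periodic
  FCI-group every element outside \<open>D\<close> has finite centralizer, so \<open>D\<close> is the FC-centre.  If \<open>D\<close> were
  finite, local nilpotency would yield an element outside \<open>D\<close> that is central modulo \<open>D\<close>, hence has a
  finite conjugacy class; so \<open>D\<close> is infinite.  Local nilpotency also makes the elements of prime order
  of \<open>D\<close> central, so there are only finitely many of them, and the infinite abelian subgroups \<open>M\<close> of
  \<open>D\<close> have unbounded exponent.

  Let \<open>x \<notin> D\<close> with \<open>x\<^sup>p \<in> D\<close>, and let \<open>M\<close> centralize \<open>x\<^sup>p\<close>.  The product of the \<open>p\<close> conjugates of
  \<open>u \<in> M\<close> under powers of \<open>x\<close> lies in the finite centralizer of \<open>x\<close>, so it is trivial for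
  infinitely many \<open>u\<close>.  On an element of order \<open>p\<^sup>2\<close> it equals \<open>u\<^sup>p\<close> if \<open>p\<close> is odd.  Therefore
  \<open>p = 2\<close> and \<open>x\<close> inverts infinitely many elements of \<open>M\<close>.  It follows that \<open>D\<close> has index 2 and
  that \<open>x\<close> inverts all 2-elements of \<open>D\<close>, while the elements of odd order of \<open>D\<close> commute as in the
  theorem on Dedekind groups of odd order.  Conversely, in \<open>P \<times> Q\<close> the elements of \<open>A \<times> Q\<close> generate
  normal subgroups, all others have finite centralizers, and commutators with \<open>g\<close> are squares of
  elements of \<open>A\<close>.\<close>

section \<open>Conjugation and commutation\<close>

lemma odd_part:
  assumes "n \<noteq> 0"
  obtains k m :: nat where "n = 2 ^ k * m" "odd m"
  using assms by (metis One_nat_def dvd_1_iff_1 multiplicity_decompose' not_prime_unit two_is_prime_nat)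

lemma prime_power_of_unique_prime:
  assumes n: "n \<noteq> 0" and p: "prime (p::nat)" and uniq: "\<And>q. prime q \<Longrightarrow> q dvd n \<Longrightarrow> q = p"
  obtains k where "n = p ^ k"
proof -
  obtain m where m: "n = p ^ multiplicity p n * m" "\<not> p dvd m"
    using multiplicity_decompose'[of n p] n p by (metis not_prime_unit)
  have "m = 1"
  proof (rule ccontr)
    assume "m \<noteq> 1"
    then obtain q where q: "prime q" "q dvd m" using prime_factor_nat by blast
    then have "q dvd n" using m(1) dvd_mult by metis
    then show False using uniq q m(2) by blast
  qed
  then show thesis using that m(1) by simp
qed

text \<open>The sum is \<open>n (n - 1) / 2\<close>. It arises as the exponent of a commutator in
  traces and in powers of products, and oddness of \<open>n\<close> lets the factor 2 be
  cancelled.\<close>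

lemma odd_dvd_sum_lessThan:
  assumes "odd (n::nat)"
  shows "n dvd (\<Sum>i<n. i)"
proof -
  have "2 * (\<Sum>i<n. i) = n * (n - 1)"
    by (induction n) (auto simp: algebra_simps diff_mult_distrib2)
  then have "n dvd 2 * (\<Sum>i<n. i)" by simp
  moreover have "coprime n 2" using assms by simp
  ultimately show ?thesis using coprime_dvd_mult_right_iff by blast
qed

text \<open>This is \<open>y^g\<close>, a right action: conjugating by \<open>g\<close> and then by
  \<open>h\<close> is conjugating by the product \<open>g h\<close>.\<close>

definition conjugate :: "('a, 'b) monoid_scheme \<Rightarrow> 'a \<Rightarrow> 'a \<Rightarrow> 'a" where
  "conjugate G g y = inv\<^bsub>G\<^esub> g \<otimes>\<^bsub>G\<^esub> y \<otimes>\<^bsub>G\<^esub> g"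

context group
begin

lemma inv_cancel_left [simp]: "x \<in> carrier G \<Longrightarrow> y \<in> carrier G \<Longrightarrow> inv x \<otimes> (x \<otimes> y) = y"
  by (simp flip: m_assoc)

lemma cancel_inv_left [simp]: "x \<in> carrier G \<Longrightarrow> y \<in> carrier G \<Longrightarrow> x \<otimes> (inv x \<otimes> y) = y"
  by (simp flip: m_assoc)

lemma conj_closed [simp, intro]: "g \<in> carrier G \<Longrightarrow> y \<in> carrier G \<Longrightarrow> conjugate G g y \<in> carrier G"
  by (simp add: conjugate_def)

lemma conj_mult:
  "g \<in> carrier G \<Longrightarrow> y \<in> carrier G \<Longrightarrow> z \<in> carrier G \<Longrightarrow> conjugate G g (y \<otimes> z) = conjugate G g y \<otimes> conjugate G g z"
  by (simp add: conjugate_def m_assoc)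

lemma conj_one [simp]: "g \<in> carrier G \<Longrightarrow> conjugate G g \<one> = \<one>"
  by (simp add: conjugate_def)

lemma conj_by_one [simp]: "y \<in> carrier G \<Longrightarrow> conjugate G \<one> y = y"
  by (simp add: conjugate_def)

lemma conj_inv: "g \<in> carrier G \<Longrightarrow> y \<in> carrier G \<Longrightarrow> conjugate G g (inv y) = inv (conjugate G g y)"
  by (simp add: conjugate_def m_assoc inv_mult_group)

lemma conj_pow: "g \<in> carrier G \<Longrightarrow> y \<in> carrier G \<Longrightarrow> conjugate G g (y [^] (n::nat)) = conjugate G g y [^] n"
  by (induction n) (auto simp: conj_mult)

lemma conj_conj:
  "g \<in> carrier G \<Longrightarrow> h \<in> carrier G \<Longrightarrow> y \<in> carrier G \<Longrightarrow> conjugate G h (conjugate G g y) = conjugate G (g \<otimes> h) y"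
  by (simp add: conjugate_def m_assoc inv_mult_group)

lemma conj_eq_iff:
  "g \<in> carrier G \<Longrightarrow> y \<in> carrier G \<Longrightarrow> z \<in> carrier G \<Longrightarrow> conjugate G g y = z \<longleftrightarrow> y \<otimes> g = g \<otimes> z"
  by (simp add: conjugate_def m_assoc inv_solve_left')

lemma conj_fix_iff:
  "g \<in> carrier G \<Longrightarrow> y \<in> carrier G \<Longrightarrow> conjugate G g y = y \<longleftrightarrow> y \<otimes> g = g \<otimes> y"
  by (simp add: conj_eq_iff)

lemma conj_inject [simp]:
  "g \<in> carrier G \<Longrightarrow> y \<in> carrier G \<Longrightarrow> z \<in> carrier G \<Longrightarrow> conjugate G g y = conjugate G g z \<longleftrightarrow> y = z"
  by (simp add: conjugate_def m_assoc)

lemma conj_conj_inv [simp]: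
  "g \<in> carrier G \<Longrightarrow> y \<in> carrier G \<Longrightarrow> conjugate G g (conjugate G (inv g) y) = y"
  by (simp add: conj_conj)

lemma conj_inv_conj [simp]:
  "g \<in> carrier G \<Longrightarrow> y \<in> carrier G \<Longrightarrow> conjugate G (inv g) (conjugate G g y) = y"
  by (simp add: conj_conj)

lemma centralizer_iff: "y \<in> centralizer G x \<longleftrightarrow> y \<in> carrier G \<and> y \<otimes> x = x \<otimes> y"
  by (simp add: centralizer_def)

lemma commute_inv_left:
  assumes "x \<in> carrier G" "y \<in> carrier G" "x \<otimes> y = y \<otimes> x"
  shows "inv x \<otimes> y = y \<otimes> inv x"
  using assms by (metis inv_closed inv_solve_left inv_solve_right m_assoc m_closed)

lemma commute_mult_left:
  assumes "x \<in> carrier G" "y \<in> carrier G" "z \<in> carrier G" "x \<otimes> z = z \<otimes> x" "y \<otimes> z = z \<otimes> y"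
  shows "(x \<otimes> y) \<otimes> z = z \<otimes> (x \<otimes> y)"
  using assms by (metis m_assoc)

lemma centralizer_subgroup:
  assumes "x \<in> carrier G"
  shows "subgroup (centralizer G x) G"
  using assms
  by (intro subgroupI) (auto simp: centralizer_iff commute_inv_left commute_mult_left)

text \<open>Right division by a fixed element embeds each fibre of \<open>f\<close> into
  \<open>K\<close>. The lemma serves orbit maps, commutator maps and homomorphisms alike, with
  \<open>K\<close> a stabilizer or a kernel.\<close>

lemma finite_of_finite_fibres:
  assumes "X \<subseteq> carrier G" "finite (f ` X)" "finite K"
    and "\<And>u v. u \<in> X \<Longrightarrow> v \<in> X \<Longrightarrow> f u = f v \<Longrightarrow> u \<otimes> inv v \<in> K"
  shows "finite X"
proof (rule ccontr)
  assume "infinite X"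
  then obtain v where v: "v \<in> X" "infinite {u \<in> X. f u = f v}"
    using pigeonhole_infinite[OF _ assms(2)] by blast
  have "inj_on (\<lambda>u. u \<otimes> inv v) {u \<in> X. f u = f v}"
    using v assms(1) by (intro inj_onI) (auto simp: subset_iff)
  moreover have "(\<lambda>u. u \<otimes> inv v) ` {u \<in> X. f u = f v} \<subseteq> K"
    using v assms(4) by auto
  ultimately show False
    using v(2) assms(3) by (metis finite_imageD finite_subset)
qed

text \<open>Orbit-stabilizer argument: if \<open>u\<close> and \<open>v\<close> conjugate
  \<open>y\<close> to the same element, then \<open>u v^-1\<close> centralizes
  \<open>y\<close>.\<close>

lemma infinite_centralizer_of_finite_class:
  assumes X: "subgroup X G" "infinite X" and y: "y \<in> carrier G" and fin: "finite ((\<lambda>g. conjugate G g y) ` X)"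
  shows "infinite (X \<inter> centralizer G y)"
proof
  assume fin': "finite (X \<inter> centralizer G y)"
  interpret X: subgroup X G by fact
  have "finite X"
  proof (rule finite_of_finite_fibres[OF X.subset fin fin'])
    fix u v assume uv: "u \<in> X" "v \<in> X" "conjugate G u y = conjugate G v y"
    then have "conjugate G (u \<otimes> inv v) y = y"
      using y by (metis conj_conj conj_conj_inv X.m_inv_closed X.mem_carrier inv_inv)
    then show "u \<otimes> inv v \<in> X \<inter> centralizer G y"
      using uv y by (simp add: centralizer_iff conj_fix_iff)
  qed
  with X show False by simp
qed

lemma pow_eq_one_of_coprime:
  assumes "x \<in> carrier G" "x [^] (m::nat) = \<one>" "x [^] (n::nat) = \<one>" "coprime m n"
  shows "x = \<one>"
  using assms by (metis coprime_common_divisor_nat ord_eq_1 pow_eq_id)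

lemma pow_two: "x \<in> carrier G \<Longrightarrow> x [^] (2::nat) = x \<otimes> x"
  by (simp add: numeral_2_eq_2)

lemma subgroup_pow_closed: "subgroup H G \<Longrightarrow> x \<in> H \<Longrightarrow> x [^] (n::nat) \<in> H"
  by (induction n) (auto simp: subgroup.one_closed subgroup.m_closed)

lemma pow_cong:
  assumes "x \<in> carrier G" "x [^] (n::nat) = \<one>" "[a = b] (mod n)"
  shows "x [^] a = x [^] b"
proof -
  have "x [^] c = x [^] (c mod n)" for c
  proof -
    have "x [^] c = x [^] (n * (c div n) + c mod n)" by simp
    also have "\<dots> = (x [^] n) [^] (c div n) \<otimes> x [^] (c mod n)"
      using assms(1) by (simp only: nat_pow_mult nat_pow_pow)
    finally show ?thesis using assms by simp
  qed
  then show ?thesis using assms(3) by (metis cong_def)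
qed

lemma pow_pow_eq_one:
  assumes "x \<in> carrier G" "x [^] (n::nat) = \<one>"
  shows "(x [^] (m::nat)) [^] n = \<one>"
proof -
  have "(x [^] m) [^] n = (x [^] n) [^] m" using assms(1) by (simp only: nat_pow_pow mult.commute)
  then show ?thesis using assms(2) by simp
qed

lemma ord_pow_dvd:
  assumes x: "x \<in> carrier G"
  shows "ord (x [^] (n::nat)) dvd ord x"
  using pow_pow_eq_one[OF x pow_ord_eq_1[OF x]] x pow_eq_id by blast

lemma two_power_pow_mono:
  assumes "x \<in> carrier G" "x [^] (2 ^ k :: nat) = \<one>" "k \<le> m"
  shows "x [^] (2 ^ m :: nat) = \<one>"
proof -
  have "(2::nat) ^ k dvd 2 ^ m" using assms(3) by (rule le_imp_power_dvd)
  then show ?thesis using assms by (metis dvdE nat_pow_one nat_pow_pow)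
qed

lemma prime_eq_of_pow_eq_one:
  assumes "v \<in> carrier G" "v \<noteq> \<one>" "prime p" "v [^] (p::nat) = \<one>" "prime q" "v [^] (q::nat) = \<one>"
  shows "p = q"
  using assms pow_eq_one_of_coprime primes_coprime by blast

text \<open>With the order written as \<open>2^k m\<close>, \<open>m\<close> odd, the Chinese
  remainder theorem gives \<open>i\<close> congruent to 1 and 0, and \<open>j\<close> congruent to 0
  and 1, modulo \<open>2^k\<close> and \<open>m\<close>.\<close>

lemma power_part_decomposition:
  assumes x: "x \<in> carrier G" "ord x \<noteq> 0"
  obtains i j k m :: nat where "x = x [^] i \<otimes> x [^] j" "(x [^] i) [^] (2 ^ k :: nat) = \<one>"
    "odd m" "(x [^] j) [^] m = \<one>"
proof -
  obtain k m where km: "ord x = 2 ^ k * m" "odd m"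
    by (rule odd_part[OF x(2)])
  have cop: "coprime (2 ^ k) m" using km by simp
  obtain i where i: "[i = 1] (mod 2 ^ k)" "[i = 0] (mod m)"
    using binary_chinese_remainder_nat[OF cop] by blast
  obtain j where j: "[j = 0] (mod 2 ^ k)" "[j = 1] (mod m)"
    using binary_chinese_remainder_nat[OF cop] by blast
  have "[i + j = 1] (mod 2 ^ k)" "[i + j = 1] (mod m)"
    using cong_add[OF i(1) j(1)] cong_add[OF i(2) j(2)] by simp_all
  then have "[i + j = 1] (mod ord x)"
    using km cop coprime_cong_mult_nat by metis
  then have "x [^] int (i + j) = x [^] (1::int)"
    using x int_pow_eq[of x "int (i+j)" 1]
    by (metis cong_iff_dvd_diff cong_int_iff cong_sym of_nat_1)
  then have "x [^] (i + j) = x" using x by (metis int_pow_1 int_pow_int)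
  then have 1: "x = x [^] i \<otimes> x [^] j" using x by (simp add: nat_pow_mult)
  have "m dvd i" "2 ^ k dvd j" using i j by (simp_all add: cong_0_iff)
  then have 2: "ord x dvd i * 2 ^ k" "ord x dvd j * m"
    using km by (simp_all add: mult_dvd_mono mult.commute)
  show thesis
    by (rule that[OF 1 _ km(2)]) (use x 2 in \<open>simp_all add: nat_pow_pow pow_eq_id\<close>)
qed

lemma ord_consistent: "group.ord (G\<lparr>carrier := H\<rparr>) x = ord x" if "subgroup H G" "x \<in> H"
proof -
  interpret H: group "G\<lparr>carrier := H\<rparr>" using that subgroup.subgroup_is_group by blast
  show ?thesis
    using that by (subst H.ord_unique) (auto simp: pow_eq_id subgroup.mem_carrier simp flip: nat_pow_consistent)
qed

end

section \<open>Elements generating normal cyclic subgroups\<close>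

text \<open>For elements of finite order natural exponents reach the whole cyclic subgroup, so this
  says that \<open>y\<close> generates a normal subgroup; see
  \<open>generate_normal_iff\<close>.\<close>

definition cyclic_normals :: "('a, 'b) monoid_scheme \<Rightarrow> 'a set" where
  "cyclic_normals G = {y \<in> carrier G. \<forall>g\<in>carrier G. \<exists>n::nat. conjugate G g y = y [^]\<^bsub>G\<^esub> n}"

context group
begin

lemma conj_consistent: "subgroup H G \<Longrightarrow> g \<in> H \<Longrightarrow> conjugate (G\<lparr>carrier := H\<rparr>) g y = conjugate G g y"
  by (simp add: conjugate_def)

section \<open>The lower central series and local nilpotency\<close>

lemma lower_central_subgroup: "subgroup (lower_central G n) G"
proof (induction n)
  case 0
  then show ?case by (simp add: subgroup_self)
next
  case (Suc n)
  then have "lower_central G n \<subseteq> carrier G" by (rule subgroup.subset)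
  then show ?case
    by (auto simp: commutator_subgroup_def subset_iff intro!: generate_is_subgroup)
qed

lemma lower_central_commutator:
  assumes "x \<in> lower_central G n" "y \<in> carrier G"
  shows "inv x \<otimes> conjugate G y x \<in> lower_central G (Suc n)"
proof -
  have "x \<in> carrier G" using assms(1) lower_central_subgroup subgroup.mem_carrier by fast
  then have "inv x \<otimes> conjugate G y x = inv x \<otimes> inv y \<otimes> x \<otimes> y"
    using assms by (simp add: conjugate_def m_assoc)
  then show ?thesis
    using assms by (auto simp: commutator_subgroup_def intro!: generate.incl)
qed

text \<open>Comparison with a central-type series: the generating commutators of each term of the
  lower central series of \<open>H\<close> fall into the next \<open>K\<close>, which is a
  subgroup.\<close>

lemma lower_central_subset:
  assumes H: "subgroup H G" and K: "\<And>n. subgroup (K n) G" "H \<subseteq> K 0"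
    and comm: "\<And>n x y. x \<in> K n \<Longrightarrow> y \<in> H \<Longrightarrow> inv x \<otimes> conjugate G y x \<in> K (Suc n)"
  shows "lower_central (G\<lparr>carrier := H\<rparr>) n \<subseteq> K n"
proof (induction n)
  case 0
  then show ?case using K by simp
next
  case (Suc n)
  interpret H: group "G\<lparr>carrier := H\<rparr>" using H by (rule subgroup.subgroup_is_group) simp
  interpret HS: subgroup H G by fact
  define L where "L = lower_central (G\<lparr>carrier := H\<rparr>) n"
  have L: "L \<subseteq> H" using H.lower_central_subgroup[of n] subgroup.subset by (force simp: L_def)
  define X where "X = {inv x \<otimes> inv y \<otimes> x \<otimes> y | x y. x \<in> L \<and> y \<in> H}"
  have "lower_central (G\<lparr>carrier := H\<rparr>) (Suc n) = generate (G\<lparr>carrier := H\<rparr>) X"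
    using L H by (auto simp: commutator_subgroup_def X_def L_def subset_iff
        intro!: arg_cong2[where f = generate] Collect_cong) (metis m_inv_consistent)+
  also have "\<dots> = generate G X"
    using L H by (intro generate_consistent) (auto simp: X_def subset_iff)
  also have "\<dots> \<subseteq> K (Suc n)"
  proof (intro generate_subgroup_incl K(1) subsetI)
    fix z assume "z \<in> X"
    then obtain x y where xy: "x \<in> L" "y \<in> H" "z = inv x \<otimes> inv y \<otimes> x \<otimes> y" by (auto simp: X_def)
    moreover have "x \<in> K n" using xy(1) Suc by (auto simp: L_def)
    moreover have "x \<in> carrier G" "y \<in> carrier G" using xy L by auto
    ultimately show "z \<in> K (Suc n)"
      using comm[of x n y] by (simp add: conjugate_def m_assoc)
  qed
  finally show ?case .
qed

text \<open>If \<open>y\<close> is a power of \<open>[y,g]\<close>, membership of \<open>y\<close>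
  passes from each term of the lower central series of the group generated by \<open>y\<close> and
  \<open>g\<close> to the next, and that series reaches the trivial group.\<close>

lemma locally_nilpotent_commutator_generates:
  assumes ln: "locally_nilpotent_group G" and y: "y \<in> carrier G" and g: "g \<in> carrier G"
    and eq: "y = (inv y \<otimes> conjugate G g y) [^] (n::nat)"
  shows "y = \<one>"
proof -
  define H where "H = generate G {y, g}"
  have H: "subgroup H G" using y g by (simp add: H_def generate_is_subgroup)
  interpret H: group "G\<lparr>carrier := H\<rparr>" using H by (rule subgroup.subgroup_is_group) simp
  have yH: "y \<in> H" "g \<in> H" by (auto simp: H_def intro: generate.incl)
  have "y \<in> lower_central (G\<lparr>carrier := H\<rparr>) k" for k
  proof (induction k)
    case 0
    then show ?case using yH by simp
  next
    case (Suc k)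
    have "inv y \<otimes> conjugate G g y \<in> lower_central (G\<lparr>carrier := H\<rparr>) (Suc k)"
      using H.lower_central_commutator[OF Suc, of g] yH H by (simp add: conj_consistent)
    then have "(inv y \<otimes> conjugate G g y) [^] n \<in> lower_central (G\<lparr>carrier := H\<rparr>) (Suc k)"
      using H.subgroup_pow_closed[OF H.lower_central_subgroup] by (metis nat_pow_consistent)
    then show ?case using eq by simp
  qed
  moreover have "\<exists>k. lower_central (G\<lparr>carrier := H\<rparr>) k = {\<one>}"
    using ln y g by (auto simp: locally_nilpotent_group_def nilpotent_group_def H_def)
  ultimately show ?thesis by blast
qed

text \<open>Any \<open>z\<close> outside \<open>D\<close> in the last term of the lower central
  series not contained in \<open>D\<close> will do. The element \<open>x\<close> shows that the
  zeroth term is not contained in \<open>D\<close>.\<close>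

lemma locally_nilpotent_central_modulo:
  assumes ln: "locally_nilpotent_group G" and S: "finite S" "S \<subseteq> carrier G"
    and x: "x \<in> generate G S" "x \<notin> D" and D: "\<one> \<in> D"
  obtains z where "z \<in> generate G S" "z \<notin> D"
    "\<And>h. h \<in> generate G S \<Longrightarrow> inv z \<otimes> conjugate G h z \<in> D"
proof -
  define H where "H = generate G S"
  have H: "subgroup H G" using S by (simp add: H_def generate_is_subgroup)
  interpret H: group "G\<lparr>carrier := H\<rparr>" using H by (rule subgroup.subgroup_is_group) simp
  obtain n where "lower_central (G\<lparr>carrier := H\<rparr>) n = {\<one>}"
    using ln S by (auto simp: locally_nilpotent_group_def nilpotent_group_def H_def)
  then have "lower_central (G\<lparr>carrier := H\<rparr>) n \<subseteq> D" using D by simp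
  moreover have "\<not> lower_central (G\<lparr>carrier := H\<rparr>) 0 \<subseteq> D" using x by (auto simp: H_def)
  ultimately obtain k where k: "\<not> lower_central (G\<lparr>carrier := H\<rparr>) k \<subseteq> D"
      "lower_central (G\<lparr>carrier := H\<rparr>) (Suc k) \<subseteq> D"
    using ex_least_nat_less[of "\<lambda>n. lower_central (G\<lparr>carrier := H\<rparr>) n \<subseteq> D"] by blast
  then obtain z where z: "z \<in> lower_central (G\<lparr>carrier := H\<rparr>) k" "z \<notin> D" by auto
  have zH: "z \<in> H"
    using subgroup.subset[OF H.lower_central_subgroup[of k]] z by auto
  have "inv z \<otimes> conjugate G h z \<in> D" if "h \<in> H" for h
    using H.lower_central_commutator[OF z(1), of h] that k(2) zH H by (auto simp: conj_consistent)
  then show thesis using that z zH by (simp add: H_def)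
qed

section \<open>Cyclic normal subgroups and the FCI and Dedekind conditions\<close>

lemma generate_normal_iff:
  assumes x: "x \<in> carrier G" "ord x \<noteq> 0"
  shows "generate G {x} \<lhd> G \<longleftrightarrow> x \<in> cyclic_normals G"
proof
  have gen: "generate G {x} = {x [^] k | k. k \<in> (UNIV :: nat set)}"
    using x by (rule generate_pow_nat)
  show "x \<in> cyclic_normals G" if "generate G {x} \<lhd> G"
    using normal.inv_op_closed1[OF that, of _ x] x
    by (auto simp: gen cyclic_normals_def conjugate_def intro: generate.incl)
      (metis nat_pow_0 nat_pow_Suc l_one)
  assume D: "x \<in> cyclic_normals G"
  show "generate G {x} \<lhd> G"
    unfolding normal_inv_iff
  proof (intro conjI ballI)
    show "subgroup (generate G {x}) G" using x by (simp add: generate_is_subgroup)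
    fix g h assume g: "g \<in> carrier G" and "h \<in> generate G {x}"
    then obtain k :: nat where "h = x [^] k" by (auto simp: gen)
    then have "conjugate G (inv g) h = conjugate G (inv g) x [^] k" using g x by (simp add: conj_pow)
    moreover obtain n :: nat where "conjugate G (inv g) x = x [^] n"
      using D g by (auto simp: cyclic_normals_def)
    ultimately have "conjugate G (inv g) h = x [^] (n * k)" using x by (simp add: nat_pow_pow)
    then show "g \<otimes> h \<otimes> inv g \<in> generate G {x}"
      using g by (auto simp: gen conjugate_def)
  qed
qed

text \<open>The subgroup generated by \<open>x\<close> is finite, so all its cosets are finite, and
  the centralizer, being their union, is finite exactly when there are finitely many of
  them.\<close>

lemma finite_index_centralizer_iff:
  assumes x: "x \<in> carrier G" "ord x \<noteq> 0"
  shows "finite_index (G\<lparr>carrier := centralizer G x\<rparr>) (generate G {x}) \<longleftrightarrow> finite (centralizer G x)"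
proof -
  let ?C = "centralizer G x"
  have C: "subgroup ?C G" using x by (simp add: centralizer_subgroup)
  interpret C: group "G\<lparr>carrier := ?C\<rparr>" using C by (rule subgroup.subgroup_is_group) simp
  have xC: "x \<in> ?C" using x by (simp add: centralizer_iff)
  then have "generate (G\<lparr>carrier := ?C\<rparr>) {x} = generate G {x}"
    using C by (simp add: generate_consistent)
  then have sub: "subgroup (generate G {x}) (G\<lparr>carrier := ?C\<rparr>)"
    using xC C.generate_is_subgroup[of "{x}"] by simp
  have fin: "finite (generate G {x})"
    unfolding generate_pow_nat[OF x] ord_elems_inf_carrier[OF x] by (auto simp: Setcompr_eq_image)
  have un: "\<Union> (rcosets\<^bsub>G\<lparr>carrier := ?C\<rparr>\<^esub> (generate G {x})) = ?C"
    using C.rcosets_part_G[OF sub] by simp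
  have "finite c" if "c \<in> rcosets\<^bsub>G\<lparr>carrier := ?C\<rparr>\<^esub> (generate G {x})" for c
    using that fin by (auto simp: RCOSETS_def r_coset_def)
  then show ?thesis
    unfolding finite_index_def using un by (metis finite_Union finite_UnionD)
qed

lemma FCI_group_iff:
  assumes "periodic_group G"
  shows "FCI_group G \<longleftrightarrow> (\<forall>x\<in>carrier G - cyclic_normals G. finite (centralizer G x))"
  using assms finite_index_centralizer_iff generate_normal_iff
  by (auto simp: FCI_group_def periodic_group_def)

text \<open>A subgroup contains the powers of its elements, so it is normal as soon as conjugates of
  elements are powers of them.\<close>

lemma Dedekind_group_iff:
  assumes per: "periodic_group G"
  shows "Dedekind_group G \<longleftrightarrow> cyclic_normals G = carrier G"
proof
  have ord: "ord x \<noteq> 0" if "x \<in> carrier G" for x using per that by (auto simp: periodic_group_def)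
  show "cyclic_normals G = carrier G" if "Dedekind_group G"
    using that ord generate_normal_iff generate_is_subgroup
    by (auto simp: Dedekind_group_def cyclic_normals_def[of G])
  assume *: "cyclic_normals G = carrier G"
  show "Dedekind_group G"
    unfolding Dedekind_group_def
  proof (intro conjI allI impI)
    fix H assume H: "subgroup H G"
    show "H \<lhd> G"
      unfolding normal_inv_iff
    proof (intro conjI ballI H)
      fix g h assume g: "g \<in> carrier G" and h: "h \<in> H"
      then have "h \<in> cyclic_normals G" using * H subgroup.mem_carrier by fast
      then obtain n :: nat where "conjugate G (inv g) h = h [^] n"
        using g by (auto simp: cyclic_normals_def)
      then have "conjugate G (inv g) h \<in> H" using subgroup_pow_closed[OF H h] by simp
      then show "g \<otimes> h \<otimes> inv g \<in> H" using g by (simp add: conjugate_def)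
    qed
  qed simp
qed

end

section \<open>Infinite non-Dedekind periodic locally nilpotent FCI-groups\<close>

locale infinite_FCI_group = group G for G (structure) +
  assumes locally_nilpotent: "locally_nilpotent_group G"
    and FCI: "FCI_group G"
    and periodic: "periodic_group G"
    and infinite_carrier: "infinite (carrier G)"
    and non_Dedekind: "\<not> Dedekind_group G"
begin

abbreviation D where "D \<equiv> cyclic_normals G"

lemma D_subset: "D \<subseteq> carrier G"
  by (auto simp: cyclic_normals_def)

lemma D_closed [simp, intro]: "y \<in> D \<Longrightarrow> y \<in> carrier G"
  using D_subset by blast

lemma ord_nonzero [simp]: "x \<in> carrier G \<Longrightarrow> ord x \<noteq> 0"
  using periodic by (simp add: periodic_group_def)

lemma D_conj:
  assumes "y \<in> D" "g \<in> carrier G"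
  obtains n :: nat where "conjugate G g y = y [^] n"
  using assms unfolding cyclic_normals_def by blast

lemma finite_centralizer: "x \<in> carrier G \<Longrightarrow> x \<notin> D \<Longrightarrow> finite (centralizer G x)"
  using FCI FCI_group_iff[OF periodic] by blast

lemma exists_not_in_D: obtains x where "x \<in> carrier G" "x \<notin> D"
  using Dedekind_group_iff[OF periodic] non_Dedekind D_subset by blast

section \<open>The FC-centre\<close>

text \<open>Conjugates of an element of \<open>D\<close> are powers of it, hence finitely many.
  Conversely a finite class in an infinite group gives an infinite centralizer, which the FCI
  condition excludes outside \<open>D\<close>.\<close>

lemma D_iff_finite_class:
  assumes y: "y \<in> carrier G"
  shows "y \<in> D \<longleftrightarrow> finite ((\<lambda>g. conjugate G g y) ` carrier G)"
proof
  assume yD: "y \<in> D"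
  have "(\<lambda>g. conjugate G g y) ` carrier G \<subseteq> generate G {y}"
  proof (rule image_subsetI)
    fix g assume g: "g \<in> carrier G"
    obtain n :: nat where "conjugate G g y = y [^] n" by (rule D_conj[OF yD g])
    then show "conjugate G g y \<in> generate G {y}"
      using y by (simp add: subgroup_pow_closed generate_is_subgroup generate.incl)
  qed
  moreover have "finite (generate G {y})"
    using y generate_pow_card[OF y] ord_nonzero[OF y] by (metis card.infinite)
  ultimately show "finite ((\<lambda>g. conjugate G g y) ` carrier G)" by (rule finite_subset)
next
  assume "finite ((\<lambda>g. conjugate G g y) ` carrier G)"
  then have "infinite (centralizer G y)"
    using infinite_centralizer_of_finite_class[OF subgroup_self infinite_carrier y]
    by (metis Int_lower2 finite_subset)
  then show "y \<in> D" using finite_centralizer y by blast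
qed

text \<open>Closure under products is clear for finite classes, not for normal cyclic subgroups: the
  class of \<open>a b\<close> lies in the product of the two classes.\<close>

lemma D_subgroup: "subgroup D G"
proof (rule subgroupI[OF D_subset])
  have "(\<lambda>g. conjugate G g \<one>) ` carrier G \<subseteq> {\<one>}" by auto
  then show "D \<noteq> {}" using D_iff_finite_class[of \<one>] finite_subset by blast
  show "inv a \<in> D" if a: "a \<in> D" for a
  proof -
    have "(\<lambda>g. conjugate G g (inv a)) ` carrier G = m_inv G ` (\<lambda>g. conjugate G g a) ` carrier G"
      using a by (force simp: conj_inv image_image)
    then show ?thesis
      using a D_iff_finite_class[of a] D_iff_finite_class[of "inv a"] by (metis D_closed finite_imageI inv_closed)
  qed
  show "a \<otimes> b \<in> D" if ab: "a \<in> D" "b \<in> D" for a b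
  proof -
    have "(\<lambda>g. conjugate G g (a \<otimes> b)) ` carrier G
      \<subseteq> (\<lambda>(u, v). u \<otimes> v) ` ((\<lambda>g. conjugate G g a) ` carrier G \<times> (\<lambda>g. conjugate G g b) ` carrier G)"
      using ab by (auto simp: conj_mult)
    moreover have "finite ((\<lambda>g. conjugate G g a) ` carrier G \<times> (\<lambda>g. conjugate G g b) ` carrier G)"
      using ab D_iff_finite_class[of a] D_iff_finite_class[of b] by blast
    ultimately have "finite ((\<lambda>g. conjugate G g (a \<otimes> b)) ` carrier G)"
      using finite_subset by blast
    then show ?thesis
      using ab D_iff_finite_class[of "a \<otimes> b"] by blast
  qed
qed

lemma D_one [simp]: "\<one> \<in> D" and D_mult: "a \<in> D \<Longrightarrow> b \<in> D \<Longrightarrow> a \<otimes> b \<in> D"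
  and D_inv: "a \<in> D \<Longrightarrow> inv a \<in> D" and D_pow: "a \<in> D \<Longrightarrow> a [^] (n::nat) \<in> D"
  using D_subgroup subgroup_pow_closed by (auto simp: subgroup_def)

lemma subgroup_conj_closed:
  assumes "subgroup M G" "y \<in> M" "y \<in> D" "g \<in> carrier G"
  shows "conjugate G g y \<in> M"
  by (rule D_conj[OF assms(3,4)]) (simp add: subgroup_pow_closed[OF assms(1,2)])

lemma infinite_D: "infinite D"
proof
  assume fin: "finite D"
  obtain x where x: "x \<in> carrier G" "x \<notin> D" by (rule exists_not_in_D)
  \<comment> \<open>\<open>C\<close> consists of the elements commuting with \<open>x\<close> modulo
    \<open>D\<close>. It is finite, because two elements with the same commutator with
    \<open>x\<close> differ by an element of the finite centralizer of \<open>x\<close>.\<close>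
  define C where "C = {z \<in> carrier G. inv z \<otimes> conjugate G x z \<in> D}"
  have "finite C"
  proof (rule finite_of_finite_fibres[where f = "\<lambda>z. inv z \<otimes> conjugate G x z"])
    show "C \<subseteq> carrier G" by (auto simp: C_def)
    show "finite ((\<lambda>z. inv z \<otimes> conjugate G x z) ` C)"
      by (rule finite_subset[OF _ fin]) (auto simp: C_def)
    show "finite (centralizer G x)" using x by (rule finite_centralizer)
    fix u v assume "u \<in> C" "v \<in> C" and eq: "inv u \<otimes> conjugate G x u = inv v \<otimes> conjugate G x v"
    then have uv: "u \<in> carrier G" "v \<in> carrier G" by (auto simp: C_def)
    have "inv z \<otimes> conjugate G x z = conjugate G z (inv x) \<otimes> x" if "z \<in> carrier G" for z
      using that x by (simp add: conjugate_def m_assoc)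
    then have "conjugate G u (inv x) = conjugate G v (inv x)" using eq uv x by simp
    then have "conjugate G (u \<otimes> inv v) (inv x) = inv x"
      using uv x by (metis conj_conj conj_inv_conj inv_closed)
    then have "conjugate G (u \<otimes> inv v) x = x"
      using uv x by (metis conj_inv inv_inv conj_closed inv_closed m_closed)
    then show "u \<otimes> inv v \<in> centralizer G x"
      using uv x by (simp add: centralizer_iff conj_fix_iff)
  qed
  have "\<exists>z\<in>carrier G. z \<notin> D \<and> (\<forall>h\<in>carrier G. inv z \<otimes> conjugate G h z \<in> D)"
  proof (rule ccontr)
    assume "\<not> ?thesis"
    then obtain h where h: "\<And>z. z \<in> carrier G \<Longrightarrow> z \<notin> D \<Longrightarrow> h z \<in> carrier G \<and> inv z \<otimes> conjugate G (h z) z \<notin> D"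
      by metis
    \<comment> \<open>An element outside \<open>D\<close> that is central modulo \<open>D\<close> in
      the group generated by \<open>S\<close> commutes with \<open>x\<close> modulo
      \<open>D\<close>, so it lies in \<open>C\<close>. Then its own witness \<open>h z\<close> is a
      generator, a contradiction.\<close>
    define S where "S = insert x (h ` (C - D))"
    have S: "finite S" "S \<subseteq> carrier G" using \<open>finite C\<close> h x by (auto simp: S_def C_def)
    have "x \<in> generate G S" by (auto simp: S_def intro: generate.incl)
    then obtain z where z: "z \<in> generate G S" "z \<notin> D"
      "\<And>h. h \<in> generate G S \<Longrightarrow> inv z \<otimes> conjugate G h z \<in> D"
      using locally_nilpotent_central_modulo[OF locally_nilpotent S _ x(2) D_one] by blast
    have zc: "z \<in> carrier G" using z(1) S generate_in_carrier by blast
    have "z \<in> C" using z(3)[OF \<open>x \<in> generate G S\<close>] zc by (simp add: C_def)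
    then have "h z \<in> generate G S" using z by (auto simp: S_def intro!: generate.incl)
    then show False using z(2,3) h zc by blast
  qed
  then obtain z where z: "z \<in> carrier G" "z \<notin> D" "\<And>h. h \<in> carrier G \<Longrightarrow> inv z \<otimes> conjugate G h z \<in> D" by blast
  \<comment> \<open>The class of \<open>z\<close> lies in the finite coset \<open>z D\<close>, which
    forces \<open>z\<close> into \<open>D\<close>.\<close>
  have "(\<lambda>h. conjugate G h z) ` carrier G \<subseteq> (\<lambda>d. z \<otimes> d) ` D"
  proof
    fix w assume "w \<in> (\<lambda>h. conjugate G h z) ` carrier G"
    then obtain h where "h \<in> carrier G" "w = conjugate G h z" by auto
    then have "w = z \<otimes> (inv z \<otimes> conjugate G h z)" "inv z \<otimes> conjugate G h z \<in> D" using z by auto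
    then show "w \<in> (\<lambda>d. z \<otimes> d) ` D" by blast
  qed
  then show False using z fin D_iff_finite_class[of z] by (meson finite_imageI finite_subset)
qed

section \<open>Torsion and infinite abelian subgroups of \<open>D\<close>\<close>

text \<open>The commutator \<open>[y,g]\<close> is a power of \<open>y\<close>. As \<open>p\<close>
  is prime, it is trivial or \<open>y\<close> is a power of it; in the latter case local nilpotency
  gives \<open>y = 1\<close>.\<close>

lemma prime_order_central:
  assumes y: "y \<in> D" and p: "prime p" "y [^] (p::nat) = \<one>" and g: "g \<in> carrier G"
  shows "conjugate G g y = y"
proof -
  have yc: "y \<in> carrier G" using y by simp
  obtain n :: nat where n: "conjugate G g y = y [^] n" by (rule D_conj[OF y g])
  have "y [^] (p - 1) \<otimes> y = \<one>" using p prime_gt_0_nat[OF p(1)] by (metis Suc_pred' nat_pow_Suc One_nat_def)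
  then have "inv y = y [^] (p - 1)" using yc by (simp add: inv_equality)
  then have comm: "inv y \<otimes> conjugate G g y = y [^] (p - 1 + n)" using n yc by (simp add: nat_pow_mult)
  show ?thesis
  proof (cases "p dvd p - 1 + n")
    case True
    then have "inv y \<otimes> conjugate G g y = \<one>" using comm p yc by (metis dvdE nat_pow_one nat_pow_pow)
    then show ?thesis using yc g by (simp add: inv_solve_left')
  next
    case False
    then have "coprime (p - 1 + n) p" using p by (metis prime_imp_coprime coprime_commute)
    then obtain k where "[(p - 1 + n) * k = 1] (mod p)" using cong_solve_coprime_nat by (metis One_nat_def)
    then have "y [^] ((p - 1 + n) * k) = y [^] (1::nat)" using yc p by (intro pow_cong)
    then have "y = (inv y \<otimes> conjugate G g y) [^] k" using yc comm by (simp add: nat_pow_pow)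
    then have "y = \<one>" by (rule locally_nilpotent_commutator_generates[OF locally_nilpotent yc g])
    then show ?thesis using g by simp
  qed
qed

text \<open>Induction on \<open>n\<close> through a prime factor \<open>p\<close>: the
  \<open>p\<close>-th power map sends \<open>n\<close>-torsion to \<open>n/p\<close>-torsion. Its
  kernel consists of central elements, which lie in the finite centralizer of some \<open>x\<close>
  outside \<open>D\<close>.\<close>

lemma finite_torsion:
  assumes M: "subgroup M G" "M \<subseteq> D" and comm: "\<And>a b. a \<in> M \<Longrightarrow> b \<in> M \<Longrightarrow> a \<otimes> b = b \<otimes> a"
    and n: "n \<noteq> 0"
  shows "finite {u \<in> M. u [^] (n::nat) = \<one>}"
  using n
proof (induction n rule: less_induct)
  case (less n)
  interpret M: subgroup M G by fact
  show ?case
  proof (cases "n = 1")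
    case True
    then have "{u \<in> M. u [^] n = \<one>} \<subseteq> {\<one>}" by auto
    then show ?thesis using finite_subset by blast
  next
    case False
    then obtain p where p: "prime p" "p dvd n" using prime_factor_nat by blast
    then obtain m where m: "n = p * m" by auto
    then have "m < n" "m \<noteq> 0" using less.prems p prime_gt_1_nat[OF p(1)] by auto
    then have fin: "finite {u \<in> M. u [^] m = \<one>}" using less.IH by blast
    obtain x where x: "x \<in> carrier G" "x \<notin> D" by (rule exists_not_in_D)
    have "{u \<in> M. u [^] p = \<one>} \<subseteq> centralizer G x"
      using prime_order_central[OF _ p(1) _ x(1)] x M by (auto simp: centralizer_iff conj_fix_iff subset_iff)
    then have fin2: "finite {u \<in> M. u [^] p = \<one>}" using finite_centralizer[OF x] finite_subset by blast
    show ?thesis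
    proof (rule finite_of_finite_fibres[where f = "\<lambda>u. u [^] p"])
      show "finite ((\<lambda>u. u [^] p) ` {u \<in> M. u [^] n = \<one>})"
        by (rule finite_subset[OF _ fin]) (auto simp: m nat_pow_pow subgroup_pow_closed[OF M(1)])
      show "finite {u \<in> M. u [^] p = \<one>}" by (rule fin2)
      fix u v assume uv: "u \<in> {u \<in> M. u [^] n = \<one>}" "v \<in> {u \<in> M. u [^] n = \<one>}" "u [^] p = v [^] p"
      then have "(u \<otimes> inv v) [^] p = u [^] p \<otimes> inv v [^] p" by (intro pow_mult_distrib comm) auto
      also have "\<dots> = \<one>" using uv by (simp add: nat_pow_inv)
      finally show "u \<otimes> inv v \<in> {u \<in> M. u [^] p = \<one>}" using uv by simp
    qed auto
  qed
qed

text \<open>One element of \<open>F\<close> is added at a time: it has a finite class, so it is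
  centralized by infinitely many elements of the infinite subgroup obtained so far.\<close>

lemma infinite_centralizer_finite_set:
  assumes "finite F" "F \<subseteq> D" and X: "subgroup X G" "infinite X"
  shows "infinite {u \<in> X. \<forall>f\<in>F. u \<otimes> f = f \<otimes> u}"
  using assms(1,2)
proof (induction F rule: finite_induct)
  case empty
  show ?case using X(2) by simp
next
  case (insert f F)
  interpret X: subgroup X G by fact
  define Y where "Y = {u \<in> X. \<forall>f\<in>F. u \<otimes> f = f \<otimes> u}"
  have Y: "subgroup Y G"
  proof (rule subgroupI)
    have F: "f \<in> carrier G" if "f \<in> F" for f using that insert.prems by auto
    show "Y \<subseteq> carrier G" by (auto simp: Y_def)
    have "\<one> \<in> Y" using F by (auto simp: Y_def)
    then show "Y \<noteq> {}" by blast
    show "inv a \<in> Y" if "a \<in> Y" for a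
      using that F unfolding Y_def by (blast intro: commute_inv_left X.m_inv_closed X.mem_carrier)
    show "a \<otimes> b \<in> Y" if "a \<in> Y" "b \<in> Y" for a b
      using that F unfolding Y_def by (blast intro: commute_mult_left X.m_closed X.mem_carrier)
  qed
  have "Y \<subseteq> carrier G" using Y by (rule subgroup.subset)
  then have "finite ((\<lambda>g. conjugate G g f) ` Y)"
    using insert.prems D_iff_finite_class[of f] finite_subset[OF image_mono] by (metis D_closed insert_subset)
  then have "infinite (Y \<inter> centralizer G f)"
    using insert Y by (intro infinite_centralizer_of_finite_class) (auto simp: Y_def)
  moreover have "Y \<inter> centralizer G f = {u \<in> X. \<forall>f\<in>insert f F. u \<otimes> f = f \<otimes> u}"
    by (auto simp: Y_def centralizer_iff)
  ultimately show ?case by simp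
qed

text \<open>Zorn's lemma gives a maximal commuting subset \<open>M\<close> of \<open>D\<close> that
  centralizes \<open>F\<close>. It is a subgroup by maximality; were it finite, the infinite
  centralizer of \<open>M\<close> and \<open>F\<close> in \<open>D\<close> would be contained in
  it.\<close>

lemma infinite_abelian_subgroup:
  assumes F: "finite F" "F \<subseteq> D"
  obtains M where "subgroup M G" "M \<subseteq> D" "infinite M"
    "\<And>a b. a \<in> M \<Longrightarrow> b \<in> M \<Longrightarrow> a \<otimes> b = b \<otimes> a"
    "\<And>a f. a \<in> M \<Longrightarrow> f \<in> F \<Longrightarrow> a \<otimes> f = f \<otimes> a"
proof -
  define \<A> where "\<A> = {B. B \<subseteq> D \<and> (\<forall>a\<in>B. \<forall>b\<in>B \<union> F. a \<otimes> b = b \<otimes> a)}"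
  have "\<exists>M\<in>\<A>. \<forall>X\<in>\<A>. M \<subseteq> X \<longrightarrow> X = M"
  proof (rule subset_Zorn')
    fix C assume C: "subset.chain \<A> C"
    show "\<Union>C \<in> \<A>"
      unfolding \<A>_def
    proof (intro CollectI conjI ballI)
      show "\<Union>C \<subseteq> D" using C by (auto simp: subset.chain_def \<A>_def)
      fix a b assume a: "a \<in> \<Union>C" and b: "b \<in> \<Union>C \<union> F"
      then obtain B B' where B: "B \<in> C" "a \<in> B" "B' \<in> C" "b \<in> B' \<union> F" by blast
      then have "B \<subseteq> B' \<or> B' \<subseteq> B" using C by (auto simp: subset.chain_def)
      \<comment> \<open>The larger of the two comparable members of the chain.\<close>
      then obtain B where B: "B \<in> C" "a \<in> B" "b \<in> B \<union> F" using B by blast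
      have "B \<in> \<A>" using B(1) C by (auto simp: subset.chain_def)
      then show "a \<otimes> b = b \<otimes> a" using B(2,3) unfolding \<A>_def by blast
    qed
  qed
  then obtain M where M: "M \<in> \<A>" and max: "\<And>X. X \<in> \<A> \<Longrightarrow> M \<subseteq> X \<Longrightarrow> X = M" by blast
  have mem: "u \<in> M" if "u \<in> D" "\<forall>f\<in>M \<union> F. u \<otimes> f = f \<otimes> u" for u
  proof -
    have "insert u M \<in> \<A>" using M that by (auto simp: \<A>_def)
    then show ?thesis using max by blast
  qed
  have MD: "M \<subseteq> D" and Mc: "\<And>a b. a \<in> M \<Longrightarrow> b \<in> M \<union> F \<Longrightarrow> a \<otimes> b = b \<otimes> a"
    using M by (auto simp: \<A>_def)
  have carr: "b \<in> carrier G" if "b \<in> M \<union> F" for b using that MD F by auto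
  have inf: "infinite M"
  proof
    assume "finite M"
    then have "infinite {u \<in> D. \<forall>f\<in>M \<union> F. u \<otimes> f = f \<otimes> u}"
      using F MD by (intro infinite_centralizer_finite_set D_subgroup infinite_D) auto
    moreover have "finite {u \<in> D. \<forall>f\<in>M \<union> F. u \<otimes> f = f \<otimes> u}"
      by (rule finite_subset[OF _ \<open>finite M\<close>]) (use mem in auto)
    ultimately show False by simp
  qed
  have "subgroup M G"
  proof (rule subgroupI)
    show "M \<subseteq> carrier G" using MD by auto
    show "M \<noteq> {}" using inf by auto
    show "inv a \<in> M" if a: "a \<in> M" for a
    proof (rule mem)
      show "inv a \<in> D" using a MD D_inv by blast
      show "\<forall>f\<in>M \<union> F. inv a \<otimes> f = f \<otimes> inv a"
        by (intro ballI commute_inv_left Mc carr) (use a in auto)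
    qed
    show "a \<otimes> b \<in> M" if ab: "a \<in> M" "b \<in> M" for a b
    proof (rule mem)
      show "a \<otimes> b \<in> D" using ab MD D_mult by blast
      show "\<forall>f\<in>M \<union> F. (a \<otimes> b) \<otimes> f = f \<otimes> (a \<otimes> b)"
        by (intro ballI commute_mult_left Mc carr) (use ab in auto)
    qed
  qed
  then show thesis by (rule that[OF _ MD inf]; intro Mc; simp)
qed

end

text \<open>\<open>trace G x u n\<close> is the product of \<open>u\<close> and its conjugates by \<open>x, \<dots>, x\<^sup>n\<^sup>-\<^sup>1\<close>: if \<open>x\<^sup>n\<close> and all
  conjugates commute with \<open>u\<close>, it is centralized by \<open>x\<close>.\<close>

primrec trace :: "('a, 'b) monoid_scheme \<Rightarrow> 'a \<Rightarrow> 'a \<Rightarrow> nat \<Rightarrow> 'a" where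
  "trace G x u 0 = \<one>\<^bsub>G\<^esub>"
| "trace G x u (Suc n) = trace G x u n \<otimes>\<^bsub>G\<^esub> conjugate G (x [^]\<^bsub>G\<^esub> n) u"

context group
begin

lemma trace_closed [simp, intro]:
  "x \<in> carrier G \<Longrightarrow> u \<in> carrier G \<Longrightarrow> trace G x u n \<in> carrier G"
  by (induction n) auto

text \<open>Conjugation by \<open>x\<close> shifts all factors by one; putting \<open>u\<close> in
  front restores the first factor and leaves one extra factor at the end.\<close>

lemma trace_shift:
  assumes "x \<in> carrier G" "u \<in> carrier G"
  shows "u \<otimes> conjugate G x (trace G x u n) = trace G x u n \<otimes> conjugate G (x [^] n) u"
proof (induction n)
  case 0
  then show ?case using assms by simp
next
  case (Suc n)
  have "u \<otimes> conjugate G x (trace G x u (Suc n)) = u \<otimes> conjugate G x (trace G x u n) \<otimes> conjugate G (x [^] Suc n) u"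
    using assms by (simp add: conj_mult conj_conj m_assoc)
  then show ?case using Suc by simp
qed

lemma trace_fixed:
  assumes x: "x \<in> carrier G" and u: "u \<in> carrier G" and fixed: "conjugate G x u = u"
  shows "trace G x u n = u [^] n"
proof -
  have "conjugate G (x [^] i) u = u" for i :: nat
    using x u fixed by (induction i) (auto simp flip: conj_conj)
  then show ?thesis by (induction n) auto
qed

section \<open>Powers of a product with central commutator\<close>

lemma class_two_pow_swap:
  assumes G: "w \<in> carrier G" "z \<in> carrier G" "d \<in> carrier G"
    and d: "d \<otimes> w = w \<otimes> d" "d \<otimes> z = z \<otimes> d" and eq: "z \<otimes> w = w \<otimes> z \<otimes> d"
  shows "z [^] (n::nat) \<otimes> w = w \<otimes> z [^] n \<otimes> d [^] n"
proof (induction n)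
  case 0
  then show ?case using G by simp
next
  case (Suc n)
  have "z [^] Suc n \<otimes> w = z [^] n \<otimes> (w \<otimes> z \<otimes> d)" using G eq by (simp add: m_assoc)
  also have "\<dots> = (w \<otimes> z [^] n \<otimes> d [^] n) \<otimes> (z \<otimes> d)" using G Suc by (simp flip: m_assoc)
  also have "\<dots> = w \<otimes> z [^] n \<otimes> (d [^] n \<otimes> z) \<otimes> d" using G by (simp add: m_assoc)
  also have "d [^] n \<otimes> z = z \<otimes> d [^] n" using G d by (intro group_commutes_pow) auto
  finally show ?case using G by (simp add: m_assoc)
qed

text \<open>The collection formula in class two: \<open>d\<close> is the commutator
  \<open>[z,w]\<close>, and moving the factors \<open>w\<close> to the left past \<open>z^0\<close>,
  \<open>z^1\<close> and so on costs the powers \<open>d^0\<close>, \<open>d^1\<close> and so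
  on.\<close>

lemma class_two_pow_mult:
  assumes G: "w \<in> carrier G" "z \<in> carrier G" "d \<in> carrier G"
    and d: "d \<otimes> w = w \<otimes> d" "d \<otimes> z = z \<otimes> d" and eq: "z \<otimes> w = w \<otimes> z \<otimes> d"
  shows "(w \<otimes> z) [^] (n::nat) = w [^] n \<otimes> z [^] n \<otimes> d [^] (\<Sum>i<n. i)"
proof (induction n)
  case 0
  then show ?case using G by simp
next
  case (Suc n)
  let ?s = "\<Sum>i<n. i"
  have dw: "d [^] ?s \<otimes> (w \<otimes> z) = (w \<otimes> z) \<otimes> d [^] ?s"
    using G d by (intro group_commutes_pow commute_mult_left[symmetric]) auto
  have dz: "d [^] n \<otimes> z = z \<otimes> d [^] n" using G d by (intro group_commutes_pow) auto
  have "(w \<otimes> z) [^] Suc n = w [^] n \<otimes> z [^] n \<otimes> (d [^] ?s \<otimes> (w \<otimes> z))"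
    using G Suc by (simp add: m_assoc)
  also have "\<dots> = w [^] n \<otimes> (z [^] n \<otimes> w) \<otimes> z \<otimes> d [^] ?s" using G dw by (simp add: m_assoc)
  also have "\<dots> = w [^] n \<otimes> w \<otimes> z [^] n \<otimes> (d [^] n \<otimes> z) \<otimes> d [^] ?s"
    using G class_two_pow_swap[OF G d eq, of n] by (simp add: m_assoc)
  also have "\<dots> = w [^] Suc n \<otimes> z [^] Suc n \<otimes> d [^] (n + ?s)"
    using G dz by (simp add: m_assoc flip: nat_pow_mult)
  finally show ?case by (simp add: add.commute)
qed

end

section \<open>Traces on an abelian subgroup of \<open>D\<close>\<close>

locale abelian_in_D = infinite_FCI_group +
  fixes M
  assumes M_subgroup: "subgroup M G" and M_subset: "M \<subseteq> D"
    and M_comm: "a \<in> M \<Longrightarrow> b \<in> M \<Longrightarrow> a \<otimes> b = b \<otimes> a"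
begin

sublocale M: subgroup M G by (rule M_subgroup)

lemma M_D [simp, intro]: "u \<in> M \<Longrightarrow> u \<in> D" using M_subset by blast

lemma M_pow [simp, intro]: "u \<in> M \<Longrightarrow> u [^] (n::nat) \<in> M"
  by (rule subgroup_pow_closed[OF M_subgroup])

lemma M_conj [simp, intro]: "u \<in> M \<Longrightarrow> g \<in> carrier G \<Longrightarrow> conjugate G g u \<in> M"
  by (rule subgroup_conj_closed[OF M_subgroup _ M_D])

lemma trace_mem: "u \<in> M \<Longrightarrow> x \<in> carrier G \<Longrightarrow> trace G x u n \<in> M"
  by (induction n) auto

text \<open>Conjugates of elements of \<open>M\<close> are powers of them, so all factors lie in the
  abelian group \<open>M\<close> and can be regrouped. The trace is thus an endomorphism of
  \<open>M\<close>.\<close>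

lemma trace_mult:
  assumes u: "u \<in> M" and v: "v \<in> M" and x: "x \<in> carrier G"
  shows "trace G x (u \<otimes> v) n = trace G x u n \<otimes> trace G x v n"
proof (induction n)
  case 0
  then show ?case by simp
next
  case (Suc n)
  let ?a = "trace G x u n" let ?b = "trace G x v n"
  let ?c = "conjugate G (x [^] n) u" let ?d = "conjugate G (x [^] n) v"
  have carr: "?a \<in> carrier G" "?b \<in> carrier G" "?c \<in> carrier G" "?d \<in> carrier G" using u v x by auto
  have "trace G x (u \<otimes> v) (Suc n) = ?a \<otimes> (?b \<otimes> ?c) \<otimes> ?d"
    using Suc u v x carr by (simp add: conj_mult m_assoc)
  also have "?b \<otimes> ?c = ?c \<otimes> ?b" using u v x by (intro M_comm trace_mem M_conj) auto
  finally show ?case using carr by (simp add: m_assoc)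
qed

lemma trace_pow:
  assumes u: "u \<in> M" and x: "x \<in> carrier G"
  shows "trace G x (u [^] (k::nat)) n = trace G x u n [^] k"
proof (induction k)
  case 0
  have "trace G x \<one> n = \<one>" using x by (induction n) auto
  then show ?case by simp
qed (use u x in \<open>simp add: trace_mult\<close>)

text \<open>As \<open>x^p\<close> centralizes \<open>M\<close>, \<open>trace_shift\<close> shows
  that traces are fixed by \<open>x\<close>. So the trace maps the infinite group \<open>M\<close>
  homomorphically into a finite centralizer.\<close>

lemma infinite_trace_kernel:
  assumes inf: "infinite M" and x: "x \<in> carrier G" "x \<notin> D"
    and comm: "\<And>u. u \<in> M \<Longrightarrow> u \<otimes> x [^] p = x [^] p \<otimes> u"
  shows "infinite {u \<in> M. trace G x u p = \<one>}"
proof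
  assume fin: "finite {u \<in> M. trace G x u p = \<one>}"
  have "trace G x u p \<in> centralizer G x" if u: "u \<in> M" for u
  proof -
    let ?t = "trace G x u p"
    have "u \<otimes> conjugate G x ?t = ?t \<otimes> conjugate G (x [^] p) u" using trace_shift u x by simp
    also have "conjugate G (x [^] p) u = u" using u x comm by (simp add: conj_fix_iff)
    also have "?t \<otimes> u = u \<otimes> ?t" using u x by (intro M_comm trace_mem)
    finally have "conjugate G x ?t = ?t" using u x by simp
    then show ?thesis using u x by (simp add: centralizer_iff conj_fix_iff)
  qed
  then have "finite ((\<lambda>u. trace G x u p) ` M)"
    using finite_centralizer[OF x] by (meson finite_subset image_subsetI)
  then have "finite M"
  proof (rule finite_of_finite_fibres[OF M.subset _ fin])
    fix u v assume uv: "u \<in> M" "v \<in> M" "trace G x u p = trace G x v p"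
    have "trace G x (u \<otimes> inv v) p \<otimes> trace G x v p = trace G x (u \<otimes> inv v \<otimes> v) p"
      using uv x by (simp add: trace_mult)
    also have "u \<otimes> inv v \<otimes> v = u" using uv by (simp add: m_assoc)
    finally have "trace G x (u \<otimes> inv v) p \<otimes> trace G x v p = trace G x v p" using uv by simp
    then have "trace G x (u \<otimes> inv v) p = \<one>" using uv x by (simp add: r_cancel_one)
    then show "u \<otimes> inv v \<in> {u \<in> M. trace G x u p = \<one>}" using uv by simp
  qed
  then show False using inf by simp
qed

text \<open>Since the \<open>p^N\<close>-torsion of \<open>M\<close> is finite, some
  \<open>u\<close> in \<open>K\<close> is not killed by \<open>p^N\<close>. Its order is a power of
  \<open>p\<close>, because \<open>K\<close> is closed under powers and has no element of another
  prime order.\<close>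

lemma exists_large_prime_power_order:
  assumes K: "K \<subseteq> M" "infinite K" and pow: "\<And>u k. u \<in> K \<Longrightarrow> u [^] (k::nat) \<in> K"
    and p: "prime p" and uniq: "\<And>v q. v \<in> K \<Longrightarrow> v \<noteq> \<one> \<Longrightarrow> prime q \<Longrightarrow> v [^] q = \<one> \<Longrightarrow> q = p"
  obtains u and k :: nat where "u \<in> K" "ord u = p ^ k" "N \<le> k"
proof -
  have "p ^ N \<noteq> 0" using p prime_gt_0_nat by simp
  then have "finite {u \<in> M. u [^] (p ^ N) = \<one>}"
    by (intro finite_torsion M_subgroup M_subset M_comm)
  then have "\<not> K \<subseteq> {u \<in> M. u [^] (p ^ N) = \<one>}" using K(2) finite_subset by blast
  then obtain u where u: "u \<in> K" "u [^] (p ^ N) \<noteq> \<one>" using K(1) by blast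
  have uM: "u \<in> M" using u K by blast
  obtain k where k: "ord u = p ^ k"
  proof (rule prime_power_of_unique_prime[OF _ p, of "ord u"])
    show "ord u \<noteq> 0" using uM by simp
    fix q assume q: "prime q" "q dvd ord u"
    then obtain m where m: "ord u = q * m" by auto
    have "m \<noteq> 0" "m < q * m" using m uM prime_gt_1_nat[OF q(1)] by (auto intro: Nat.gr0I)
    then have "u [^] m \<noteq> \<one>" using uM m by (simp add: pow_eq_id nat_dvd_not_less)
    moreover have "(u [^] m) [^] q = \<one>"
      using uM m by (simp add: nat_pow_pow pow_eq_id mult.commute)
    ultimately show "q = p" using uniq[OF pow[OF u(1)]] q by blast
  qed
  have "N \<le> k"
  proof (rule ccontr)
    assume "\<not> N \<le> k"
    then have "ord u dvd p ^ N" using k by (simp add: le_imp_power_dvd)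
    then show False using u uM by (simp add: pow_eq_id)
  qed
  then show thesis using that u k by blast
qed

definition inverted where "inverted x = {u \<in> M. conjugate G x u = inv u}"

lemma inverted_subset: "inverted x \<subseteq> M"
  by (auto simp: inverted_def)

lemma inverted_subgroup:
  assumes x: "x \<in> carrier G"
  shows "subgroup (inverted x) G"
proof (rule subgroupI)
  show "inverted x \<subseteq> carrier G" by (auto simp: inverted_def)
  have "\<one> \<in> inverted x" using x by (simp add: inverted_def)
  then show "inverted x \<noteq> {}" by blast
  show "inv a \<in> inverted x" if "a \<in> inverted x" for a
    using that x by (simp add: inverted_def conj_inv)
  show "a \<otimes> b \<in> inverted x" if "a \<in> inverted x" "b \<in> inverted x" for a b
  proof -
    have ab: "a \<in> M" "b \<in> M" "conjugate G x a = inv a" "conjugate G x b = inv b"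
      using that by (auto simp: inverted_def)
    then have "conjugate G x (a \<otimes> b) = inv (b \<otimes> a)" using x by (simp add: conj_mult inv_mult_group)
    also have "b \<otimes> a = a \<otimes> b" using ab by (intro M_comm)
    finally show ?thesis using ab by (simp add: inverted_def)
  qed
qed

text \<open>The trace of length 2 is \<open>u\<close> times \<open>u^x\<close>, so its kernel is the
  set of inverted elements.\<close>

lemma infinite_inverted:
  assumes inf: "infinite M" and x: "x \<in> carrier G" "x \<notin> D"
    and comm: "\<And>u. u \<in> M \<Longrightarrow> u \<otimes> x [^] (2::nat) = x [^] (2::nat) \<otimes> u"
  shows "infinite (inverted x)"
proof -
  have "trace G x u 2 = \<one> \<longleftrightarrow> conjugate G x u = inv u" if u: "u \<in> M" for u
  proof -
    have "trace G x u 2 = u \<otimes> conjugate G x u" using u x by (simp add: numeral_2_eq_2)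
    then show ?thesis using u x
      by (metis M.mem_carrier conj_closed inv_equality inv_comm inv_inv inv_closed r_inv)
  qed
  then have "inverted x = {u \<in> M. trace G x u 2 = \<one>}" by (auto simp: inverted_def)
  then show ?thesis using infinite_trace_kernel[OF inf x, of 2] comm by simp
qed

text \<open>An inverted element of prime order is also fixed by \<open>x\<close>, hence equals its
  inverse; so 2 is the only prime that occurs.\<close>

lemma inverted_large_order:
  assumes inf: "infinite (inverted x)" and x: "x \<in> carrier G"
  obtains u and k :: nat where "u \<in> inverted x" "ord u = 2 ^ k" "N \<le> k"
proof (rule exists_large_prime_power_order[OF inverted_subset inf _ two_is_prime_nat])
  show "u [^] k \<in> inverted x" if "u \<in> inverted x" for u and k :: nat
    using subgroup_pow_closed[OF inverted_subgroup[OF x] that] .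
  fix v and q :: nat assume v: "v \<in> inverted x" "v \<noteq> \<one>" and q: "prime q" "v [^] q = \<one>"
  then have vM: "v \<in> M" "conjugate G x v = inv v" by (auto simp: inverted_def)
  moreover have "conjugate G x v = v" using prime_order_central[OF _ q x] vM by simp
  ultimately have "v [^] (2::nat) = \<one>" by (simp add: numeral_2_eq_2) (metis r_inv M.mem_carrier)
  then show "q = 2"
    using prime_eq_of_pow_eq_one[of v q 2] q v(2) vM(1) two_is_prime_nat by simp
qed (use that in blast)

end

section \<open>The quotient by \<open>D\<close> and the action on 2-elements\<close>

context infinite_FCI_group
begin

text \<open>For odd \<open>p\<close> an element \<open>w\<close> of order \<open>p^2\<close> with
  trivial trace would exist, whereas the trace of \<open>w\<close> is \<open>w^p\<close>.\<close>

lemma prime_eq_two: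
  assumes x: "x \<in> carrier G" "x \<notin> D" and p: "prime p" and xp: "x [^] (p::nat) \<in> D"
  shows "p = 2"
proof (rule ccontr)
  assume "p \<noteq> 2"
  then have odd: "odd p" using p primes_dvd_imp_eq two_is_prime_nat by blast
  obtain M where M: "subgroup M G" "M \<subseteq> D" "infinite M"
    "\<And>a b. a \<in> M \<Longrightarrow> b \<in> M \<Longrightarrow> a \<otimes> b = b \<otimes> a"
    "\<And>a f. a \<in> M \<Longrightarrow> f \<in> {x [^] p} \<Longrightarrow> a \<otimes> f = f \<otimes> a"
    using infinite_abelian_subgroup[of "{x [^] p}"] xp by blast
  interpret M: abelian_in_D G M by (intro abelian_in_D.intro abelian_in_D_axioms.intro infinite_FCI_group_axioms M(1,2,4))
  define K where "K = {u \<in> M. trace G x u p = \<one>}"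
  have "infinite K" unfolding K_def using M x by (intro M.infinite_trace_kernel) auto
  obtain u k where u: "u \<in> K" "ord u = p ^ k" "2 \<le> k"
  proof (rule M.exists_large_prime_power_order[where K = K and p = p and N = 2])
    show "K \<subseteq> M" by (auto simp: K_def)
    show "infinite K" by fact
    show "prime p" by fact
    show "u [^] n \<in> K" if "u \<in> K" for u and n :: nat
      using that x by (simp add: K_def M.trace_pow)
    fix v and q :: nat assume v: "v \<in> K" "v \<noteq> \<one>" and q: "prime q" "v [^] q = \<one>"
    then have vM: "v \<in> M" "trace G x v p = \<one>" by (auto simp: K_def)
    have "conjugate G x v = v" using prime_order_central[OF _ q] vM x by simp
    then have "v [^] p = \<one>" using trace_fixed[of x v p] vM x by simp
    then show "q = p" using prime_eq_of_pow_eq_one[of v q p] q v(2) vM(1) p by simp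
  qed blast
  have uM: "u \<in> M" using u by (simp add: K_def)
  define w where "w = u [^] (p ^ (k - 2))"
  have w: "w \<in> M" "trace G x w p = \<one>" using u x by (auto simp: w_def K_def M.trace_pow)
  have "\<not> k \<le> Suc (k - 2)" using u(3) by simp
  then have "\<not> p ^ k dvd p ^ (k - 2) * p"
    using power_dvd_imp_le[of p k "Suc (k - 2)"] prime_gt_1_nat[OF p] by (auto simp: mult.commute)
  then have wp: "w [^] p \<noteq> \<one>" using uM u(2) by (simp add: w_def nat_pow_pow pow_eq_id)
  have "p ^ (k - 2) * (p * p) = p ^ k"
    using u(3) by (metis le_add_diff_inverse2 power2_eq_square power_add)
  then have "(w [^] p) [^] p = \<one>" using uM u(2) by (simp add: w_def nat_pow_pow pow_eq_id mult.assoc)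
  then have fix_wp: "conjugate G x (w [^] p) = w [^] p"
    using prime_order_central[OF _ p, of "w [^] p"] w x by simp
  define d where "d = inv w \<otimes> conjugate G x w"
  have dM: "d \<in> M" using w x by (simp add: d_def)
  have xw: "conjugate G x w = w \<otimes> d" using w x by (simp add: d_def)
  have "d [^] p = inv w [^] p \<otimes> conjugate G x w [^] p"
    unfolding d_def using w x by (intro pow_mult_distrib M.M_comm) auto
  also have "\<dots> = \<one>" using fix_wp w x by (simp add: nat_pow_inv flip: conj_pow)
  finally have dp: "d [^] p = \<one>" .
  have xd: "conjugate G x d = d" using prime_order_central[OF _ p dp x(1)] dM by simp
  have "conjugate G (x [^] i) w = w \<otimes> d [^] i" for i :: nat
  proof (induction i)
    case 0
    then show ?case using w by simp
  next
    case (Suc i)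
    have "conjugate G (x [^] Suc i) w = conjugate G x (conjugate G (x [^] i) w)" using w x by (simp add: conj_conj)
    also have "\<dots> = w \<otimes> (d \<otimes> d [^] i)" using Suc w x xw xd dM by (simp add: conj_mult conj_pow m_assoc)
    also have "d \<otimes> d [^] i = d [^] Suc i" using dM by (simp only: nat_pow_Suc2 M.M.mem_carrier)
    finally show ?case .
  qed
  note xiw = this
  have "trace G x w n = w [^] n \<otimes> d [^] (\<Sum>i<n. i)" for n
  proof (induction n)
    case 0
    then show ?case by simp
  next
    case (Suc n)
    let ?s = "\<Sum>i<n. i"
    have "trace G x w (Suc n) = w [^] n \<otimes> (d [^] ?s \<otimes> w) \<otimes> d [^] n"
      using Suc w dM xiw[of n] by (simp add: m_assoc)
    also have "d [^] ?s \<otimes> w = w \<otimes> d [^] ?s" using w dM by (intro M.M_comm) auto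
    finally show ?case using w dM by (simp add: m_assoc nat_pow_mult)
  qed
  \<comment> \<open>This is where \<open>p\<close> is odd: the exponent is then a multiple of
    \<open>p\<close>.\<close>
  moreover have "d [^] (\<Sum>i<p. i) = \<one>"
    using odd_dvd_sum_lessThan[OF odd] dp dM by (metis M.M.mem_carrier dvdE nat_pow_one nat_pow_pow)
  ultimately have "trace G x w p = w [^] p" using w by simp
  then show False using w wp by simp
qed

text \<open>Induction on \<open>X\<close>: since \<open>x^2\<close> is in \<open>D\<close>,
  infinitely many elements of the current \<open>M\<close> centralize it, and among those infinitely
  many are inverted by \<open>x\<close>.\<close>

lemma inverted_abelian_subgroup:
  assumes F: "finite F" "F \<subseteq> D" and X: "finite X" "\<And>x. x \<in> X \<Longrightarrow> x \<in> carrier G \<and> x \<notin> D \<and> x [^] (2::nat) \<in> D"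
  obtains M where "abelian_in_D G M" "infinite M"
    "\<And>u f. u \<in> M \<Longrightarrow> f \<in> F \<Longrightarrow> u \<otimes> f = f \<otimes> u"
    "\<And>u x. u \<in> M \<Longrightarrow> x \<in> X \<Longrightarrow> conjugate G x u = inv u"
  using X
proof (induction X arbitrary: thesis rule: finite_induct)
  case empty
  obtain M where M: "subgroup M G" "M \<subseteq> D" "infinite M"
    "\<And>a b. a \<in> M \<Longrightarrow> b \<in> M \<Longrightarrow> a \<otimes> b = b \<otimes> a"
    "\<And>a f. a \<in> M \<Longrightarrow> f \<in> F \<Longrightarrow> a \<otimes> f = f \<otimes> a"
    using infinite_abelian_subgroup[OF F] by metis
  have "abelian_in_D G M"
    by (intro abelian_in_D.intro abelian_in_D_axioms.intro infinite_FCI_group_axioms M(1,2,4))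
  then show ?case using M(3,5) by (intro empty.prems(1)) auto
next
  case (insert x X)
  obtain M where M: "abelian_in_D G M" "infinite M"
    "\<And>u f. u \<in> M \<Longrightarrow> f \<in> F \<Longrightarrow> u \<otimes> f = f \<otimes> u"
    "\<And>u x. u \<in> M \<Longrightarrow> x \<in> X \<Longrightarrow> conjugate G x u = inv u"
    using insert.IH insert.prems(2) by blast
  interpret M: abelian_in_D G M by fact
  have x: "x \<in> carrier G" "x \<notin> D" "x [^] (2::nat) \<in> D" using insert.prems(2) by auto
  define M' where "M' = {u \<in> M. \<forall>f\<in>{x [^] (2::nat)}. u \<otimes> f = f \<otimes> u}"
  have M'_sub: "M' \<subseteq> M" by (auto simp: M'_def)
  have "M' = M \<inter> centralizer G (x [^] (2::nat))" by (auto simp: M'_def centralizer_iff)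
  then have sub: "subgroup M' G"
    using subgroups_Inter_pair[OF M.M_subgroup centralizer_subgroup[of "x [^] (2::nat)"]] x by simp
  have "infinite M'"
    unfolding M'_def using x by (intro infinite_centralizer_finite_set M.M_subgroup M(2)) auto
  interpret M': abelian_in_D G M'
    using M'_sub M.M_subset M.M_comm
    by (intro abelian_in_D.intro abelian_in_D_axioms.intro infinite_FCI_group_axioms sub) blast+
  define N where "N = M'.inverted x"
  have N_sub: "N \<subseteq> M" using M'.inverted_subset M'_sub by (auto simp: N_def)
  have "infinite N" unfolding N_def
    by (rule M'.infinite_inverted[OF \<open>infinite M'\<close> x(1,2)]) (auto simp: M'_def)
  moreover have "abelian_in_D G N"
  proof (intro abelian_in_D.intro abelian_in_D_axioms.intro infinite_FCI_group_axioms)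
    show "subgroup N G" using M'.inverted_subgroup[OF x(1)] by (simp add: N_def)
    show "N \<subseteq> D" using N_sub M.M_subset by blast
    show "a \<otimes> b = b \<otimes> a" if "a \<in> N" "b \<in> N" for a b using that N_sub M.M_comm by blast
  qed
  moreover have "conjugate G x u = inv u" if "u \<in> N" for u
    using that by (simp add: N_def M'.inverted_def)
  moreover have "u \<otimes> f = f \<otimes> u" if "u \<in> N" "f \<in> F" for u f using that M(3) N_sub by blast
  ultimately show ?case using M(4) N_sub by (intro insert.prems(1)[of N]) blast+
qed

text \<open>Otherwise \<open>y^2\<close> inverts an element \<open>w\<close> of order 4. But
  \<open>y\<close> maps \<open>w\<close> to an odd power \<open>w^n\<close>, so \<open>y^2\<close>
  maps it to the power with exponent \<open>n^2\<close>, which is 1 modulo 4.\<close>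

lemma square_in_D_of_fourth:
  assumes y: "y \<in> carrier G" and y4: "y [^] (4::nat) \<in> D"
  shows "y [^] (2::nat) \<in> D"
proof (rule ccontr)
  let ?x = "y [^] (2::nat)"
  assume nin: "?x \<notin> D"
  have x2: "?x [^] (2::nat) \<in> D" using y y4 by (simp add: nat_pow_pow)
  obtain M where M: "abelian_in_D G M" "infinite M" "\<And>u x. u \<in> M \<Longrightarrow> x \<in> {?x} \<Longrightarrow> conjugate G x u = inv u"
    by (rule inverted_abelian_subgroup[of "{}" "{?x}"]) (use y nin x2 in auto)
  interpret M: abelian_in_D G M by fact
  have "M.inverted ?x = M" using M(3) by (auto simp: M.inverted_def)
  then obtain u k where u: "u \<in> M" "ord u = 2 ^ k" "2 \<le> k"
    using M.inverted_large_order[of ?x 2] M(2) y by auto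
  define w where "w = u [^] (2 ^ (k - 2) :: nat)"
  have w: "w \<in> M" using u by (simp add: w_def)
  have "\<not> k \<le> Suc (k - 2)" using u(3) by simp
  then have "\<not> (2::nat) ^ k dvd 2 ^ (k - 2) * 2"
    using power_dvd_imp_le[of "2::nat" k "Suc (k - 2)"] by (auto simp: mult.commute)
  then have w2: "w [^] (2::nat) \<noteq> \<one>" using u by (simp add: w_def nat_pow_pow pow_eq_id)
  have "2 ^ (k - 2) * 4 = (2::nat) ^ (k - 2 + 2)" by (simp only: power_add) simp
  then have "2 ^ (k - 2) * 4 = (2::nat) ^ k" using u(3) by (simp only: le_add_diff_inverse2)
  then have w4: "w [^] (4::nat) = \<one>" using u by (simp add: w_def nat_pow_pow pow_eq_id)
  obtain n :: nat where n: "conjugate G y w = w [^] n" by (rule D_conj[OF M.M_D[OF w] y])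
  \<comment> \<open>An even \<open>n\<close> would make the conjugate of \<open>w^2\<close>
    trivial.\<close>
  have "odd n"
  proof
    assume "even n"
    then obtain m where m: "n = 2 * m" by auto
    have "conjugate G y (w [^] (2::nat)) = (w [^] (4::nat)) [^] m"
      using w y n m by (simp add: conj_pow nat_pow_pow)
    then have "conjugate G y (w [^] (2::nat)) = conjugate G y \<one>" using w4 y by simp
    then show False using w2 w y by (subst (asm) conj_inject) auto
  qed
  then obtain b where "n = 2 * b + 1" by (rule oddE)
  then have "n * n = 1 + 4 * (b * b + b)" by (simp add: algebra_simps)
  then have "[n * n = 1] (mod 4)" by (simp only: cong_def mod_mult_self2)
  then have "w [^] (n * n) = w [^] (1::nat)" using w w4 by (intro pow_cong) auto
  moreover have "conjugate G ?x w = w [^] (n * n)"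
    using w y n by (simp add: numeral_2_eq_2 conj_pow nat_pow_pow flip: conj_conj)
  ultimately have "inv w = w" using M(3)[OF w] w by simp
  then have "w [^] (2::nat) = \<one>" using w by (simp add: numeral_2_eq_2) (metis r_inv M.M.mem_carrier)
  then show False using w2 by simp
qed

text \<open>Prime factors of \<open>n\<close> are removed one by one. A factor that cannot be
  removed is 2 by \<open>prime_eq_two\<close>, and two such factors are excluded by
  \<open>square_in_D_of_fourth\<close>.\<close>

lemma square_in_D_of_pow:
  assumes "x \<in> carrier G" "n \<noteq> 0" "x [^] (n::nat) \<in> D"
  shows "x [^] (2::nat) \<in> D"
  using assms
proof (induction n rule: less_induct)
  case (less n)
  show ?case
  proof (cases "n = 1")
    case True
    then show ?thesis using less.prems by (intro D_pow) simp
  next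
    case False
    then obtain p where p: "prime p" "p dvd n" using prime_factor_nat by blast
    then obtain m where m: "n = p * m" by auto
    have m0: "m \<noteq> 0" "m < n" using m less.prems(2) prime_gt_1_nat[OF p(1)] by auto
    have xm: "(x [^] m) [^] p \<in> D" using less.prems m by (simp add: nat_pow_pow mult.commute)
    show ?thesis
    proof (cases "x [^] m \<in> D")
      case True
      then show ?thesis using less.IH m0 less.prems(1) by blast
    next
      case False
      then have p2: "p = 2" using prime_eq_two[of "x [^] m" p] p xm less.prems(1) by simp
      show ?thesis
      proof (cases "m = 1")
        case True
        then show ?thesis using less.prems m p2 by simp
      next
        case m1: False
        then obtain q where q: "prime q" "q dvd m" using prime_factor_nat by blast
        then obtain l where l: "m = q * l" by auto
        have l0: "l \<noteq> 0" "l < m" using l m0 prime_gt_1_nat[OF q(1)] by auto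
        \<comment> \<open>Here \<open>n = 2 q l\<close>; now the factor \<open>q\<close> is to be
          removed instead of 2.\<close>
        have xl: "(x [^] (2 * l)) [^] q \<in> D"
          using less.prems m p2 l by (simp add: nat_pow_pow mult_ac)
        show ?thesis
        proof (cases "x [^] (2 * l) \<in> D")
          case True
          then show ?thesis using less.IH[of "2 * l"] l0 m p2 less.prems(1) by simp
        next
          case False
          then have "q = 2" using prime_eq_two[of "x [^] (2 * l)" q] q xl less.prems(1) by simp
          then have "(x [^] l) [^] (4::nat) \<in> D"
            using less.prems m p2 l by (simp add: nat_pow_pow mult_ac)
          then have "(x [^] l) [^] (2::nat) \<in> D"
            using less.prems(1) by (intro square_in_D_of_fourth) auto
          then have "x [^] (2 * l) \<in> D" using less.prems(1) by (simp add: nat_pow_pow mult_ac)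
          then show ?thesis using False by simp
        qed
      qed
    qed
  qed
qed

lemma square_in_D: "x \<in> carrier G \<Longrightarrow> x [^] (2::nat) \<in> D"
  using square_in_D_of_pow[of x "ord x"] by simp

text \<open>Both factors invert a common infinite \<open>M\<close>, so the product centralizes
  \<open>M\<close> and has an infinite centralizer. Thus \<open>D\<close> has index 2.\<close>

lemma mult_in_D:
  assumes x: "x \<in> carrier G" "x \<notin> D" and y: "y \<in> carrier G" "y \<notin> D"
  shows "x \<otimes> y \<in> D"
proof (rule ccontr)
  assume "x \<otimes> y \<notin> D"
  then have fin: "finite (centralizer G (x \<otimes> y))" using x y by (intro finite_centralizer) auto
  obtain M where M: "abelian_in_D G M" "infinite M" "\<And>u z. u \<in> M \<Longrightarrow> z \<in> {x, y} \<Longrightarrow> conjugate G z u = inv u"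
    by (rule inverted_abelian_subgroup[of "{}" "{x, y}"]) (use x y square_in_D in auto)
  interpret M: abelian_in_D G M by fact
  have "M \<subseteq> centralizer G (x \<otimes> y)"
  proof
    fix u assume u: "u \<in> M"
    have "conjugate G (x \<otimes> y) u = conjugate G y (conjugate G x u)" using u x y by (simp add: conj_conj)
    also have "\<dots> = u" using M(3)[OF u] u y by (simp add: conj_inv)
    finally show "u \<in> centralizer G (x \<otimes> y)" using u x y by (simp add: centralizer_iff conj_fix_iff)
  qed
  then show False using fin M(2) finite_subset by blast
qed

text \<open>Choose an infinite abelian \<open>M\<close> that centralizes \<open>y\<close> and is inverted by \<open>x\<close>.  For \<open>u \<in> M\<close> of
  large order \<open>v\<^sup>x v = (v u)\<^sup>x v u\<close> is a power both of \<open>v\<close> and of \<open>v u\<close>; if it is nontrivial, the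
  involution of \<open>\<langle>v\<rangle>\<close> lies in \<open>\<langle>u\<rangle>\<close>, and \<open>v\<close> can be divided by an element of \<open>\<langle>u\<rangle>\<close> to lower its
  order.\<close>

lemma two_element_inverted:
  assumes x: "x \<in> carrier G" "x \<notin> D" and y: "y \<in> D" "y [^] (2 ^ k :: nat) = \<one>"
  shows "conjugate G x y = inv y"
proof -
  obtain M where M: "abelian_in_D G M" "infinite M" "\<And>u f. u \<in> M \<Longrightarrow> f \<in> {y} \<Longrightarrow> u \<otimes> f = f \<otimes> u"
      "\<And>u z. u \<in> M \<Longrightarrow> z \<in> {x} \<Longrightarrow> conjugate G z u = inv u"
    by (rule inverted_abelian_subgroup[of "{y}" "{x}"]) (use x y square_in_D in auto)
  interpret M: abelian_in_D G M by fact
  have inverted: "M.inverted x = M" using M(4) by (auto simp: M.inverted_def)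
  have "conjugate G x v = inv v"
    if "v \<in> D" "v [^] (2 ^ k :: nat) = \<one>" "\<And>u. u \<in> M \<Longrightarrow> u \<otimes> v = v \<otimes> u" for v k
    using that
  proof (induction k arbitrary: v)
    case 0
    then show ?case using x by simp
  next
    case (Suc k)
    note v = Suc.prems
    define w where "w = v [^] (2 ^ k :: nat)"
    have w2: "w [^] (2::nat) = \<one>" using v by (simp add: w_def nat_pow_pow mult.commute)
    have wc: "w \<in> carrier G" using v by (simp add: w_def)
    show ?case
    proof (cases "w = \<one> \<or> conjugate G x v \<otimes> v = \<one>")
      case True
      then show ?thesis
      proof
        assume "w = \<one>"
        then show ?thesis using Suc.IH v by (simp add: w_def)
      next
        assume "conjugate G x v \<otimes> v = \<one>"
        then show ?thesis using v x by (metis inv_equality conj_closed D_closed)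
      qed
    next
      case False
      then have wn: "w \<noteq> \<one>" and zn: "conjugate G x v \<otimes> v \<noteq> \<one>" by auto
      define z where "z = conjugate G x v \<otimes> v"
      obtain s :: nat where "conjugate G x v = v [^] s" by (rule D_conj[OF v(1) x(1)])
      then have z: "z = v [^] Suc s" using v by (simp add: z_def)
      obtain a b where ab: "Suc s = 2 ^ a * b" "odd b"
        by (rule odd_part[of "Suc s"]) auto
      have "a \<le> k"
      proof (rule ccontr)
        assume "\<not> a \<le> k"
        then have "2 ^ Suc k dvd Suc s" unfolding ab by (intro dvd_mult2 le_imp_power_dvd) simp
        then have "v [^] Suc s = \<one>" using v by (metis D_closed dvdE nat_pow_one nat_pow_pow)
        then show False using zn z z_def by simp
      qed
      \<comment> \<open>So the involution \<open>w\<close> is a power of \<open>z\<close>: raising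
        \<open>z\<close> to \<open>2^(k - a)\<close> gives \<open>w^b\<close> with \<open>b\<close>
        odd.\<close>
      then have "Suc s * 2 ^ (k - a) = 2 ^ k * b"
        by (simp add: ab(1) mult.assoc mult.left_commute flip: power_add)
      then have "z [^] (2 ^ (k - a) :: nat) = w [^] b" using v z by (simp only: w_def nat_pow_pow D_closed)
      also have "\<dots> = w [^] (1::nat)" using ab(2) w2 wc by (intro pow_cong[of _ 2]) (auto simp: cong_def odd_iff_mod_2_eq_one)
      finally have wz: "w = z [^] (2 ^ (k - a) :: nat)" using wc by simp
      \<comment> \<open>The order is large enough that \<open>u^i\<close> can be killed by the
        exponent \<open>2^(k+1)\<close> only if \<open>2^(k+1)\<close> divides \<open>i\<close>;
        then \<open>v^i = 1\<close>.\<close>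
      obtain u N where u: "u \<in> M" "ord u = 2 ^ N" "2 * Suc k \<le> N"
        using M.inverted_large_order[of x "2 * Suc k"] M(2) x(1) inverted by metis
      have uv: "u \<otimes> v = v \<otimes> u" using v(3) u by blast
      have uc: "u \<in> carrier G" and vc: "v \<in> carrier G" using u v by auto
      obtain j :: nat where j: "conjugate G x (v \<otimes> u) = (v \<otimes> u) [^] j"
        by (rule D_conj[OF D_mult[OF v(1) M.M_D[OF u(1)]] x(1)])
      \<comment> \<open>Replacing \<open>v\<close> by \<open>v u\<close> does not change
        \<open>z\<close>, because \<open>x\<close> inverts \<open>u\<close>. So \<open>z\<close>,
        and with it \<open>w\<close>, is also a power of \<open>v u\<close>.\<close>
      have "z = conjugate G x v \<otimes> inv u \<otimes> (u \<otimes> v)" using uc vc x by (simp add: z_def m_assoc)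
      also have "conjugate G x v \<otimes> inv u = conjugate G x (v \<otimes> u)" using M(4)[OF u(1)] uc vc x by (simp add: conj_mult)
      also have "\<dots> \<otimes> (u \<otimes> v) = (v \<otimes> u) [^] Suc j" using j uv by simp
      finally have "w = (v \<otimes> u) [^] (Suc j * 2 ^ (k - a))" using wz uc vc by (simp only: nat_pow_pow m_closed)
      then obtain i :: nat where "w = (v \<otimes> u) [^] i" by blast
      then have wi: "w = v [^] i \<otimes> u [^] i" using pow_mult_distrib[OF uv[symmetric] vc uc] by simp
      have vu_i: "v [^] i \<otimes> u [^] i = u [^] i \<otimes> v [^] i" for i :: nat
        using uv uc vc by (metis group_commutes_pow nat_pow_closed)
      have "w [^] (2 ^ Suc k :: nat) = (v [^] i) [^] (2 ^ Suc k :: nat) \<otimes> (u [^] i) [^] (2 ^ Suc k :: nat)"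
        unfolding wi using uc vc by (intro pow_mult_distrib vu_i) auto
      moreover have "w [^] (2 ^ Suc k :: nat) = \<one>"
        using w2 wc by (metis nat_pow_one nat_pow_pow power_Suc)
      moreover have "(v [^] i) [^] (2 ^ Suc k :: nat) = \<one>"
        using v(2) vc by (metis nat_pow_one nat_pow_pow mult.commute)
      ultimately have "u [^] (i * 2 ^ Suc k) = \<one>" using uc by (simp add: nat_pow_pow)
      then have "2 ^ N dvd i * 2 ^ Suc k" using u uc by (simp add: pow_eq_id)
      moreover have "(2::nat) ^ Suc k * 2 ^ Suc k dvd 2 ^ N"
        using u(3) by (metis le_imp_power_dvd mult_2 power_add)
      ultimately have "2 ^ Suc k * 2 ^ Suc k dvd i * 2 ^ Suc k" using dvd_trans by blast
      then have "2 ^ Suc k dvd i" by simp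
      then obtain i' where i': "i = 2 ^ Suc k * i'" by auto
      have "v [^] i = \<one>" using v(2) vc i' by (metis nat_pow_one nat_pow_pow)
      then have wu: "w = u [^] i" using wi uc by simp
      \<comment> \<open>The \<open>2^k\<close>-th power of \<open>u'\<close> is
        \<open>u^i = w\<close>, the same as that of \<open>v\<close>; hence the quotient
        \<open>v'\<close> is killed by \<open>2^k\<close> and the induction hypothesis
        applies.\<close>
      define u' where "u' = u [^] (2 * i')"
      have u'M: "u' \<in> M" using u by (simp add: u'_def)
      have u'w: "u' [^] (2 ^ k :: nat) = w" using uc i' by (simp add: u'_def wu nat_pow_pow mult_ac)
      define v' where "v' = v \<otimes> inv u'"
      have u'v: "u' \<otimes> v = v \<otimes> u'" using v(3) u'M by blast
      have iu'v: "inv u' \<otimes> v = v \<otimes> inv u'" using v(3) u'M by simp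
      have "v' [^] (2 ^ k :: nat) = v [^] (2 ^ k :: nat) \<otimes> inv u' [^] (2 ^ k :: nat)"
        unfolding v'_def using iu'v vc u'M by (intro pow_mult_distrib) auto
      also have "\<dots> = \<one>" using u'w u'M wc by (simp add: nat_pow_inv flip: w_def)
      finally have v'1: "v' [^] (2 ^ k :: nat) = \<one>" .
      have v'D: "v' \<in> D" using v(1) u'M by (simp add: v'_def D_mult D_inv)
      have v'M: "t \<otimes> v' = v' \<otimes> t" if t: "t \<in> M" for t
        unfolding v'_def using v(3)[OF t] M.M_comm[of "inv u'" t] t u'M vc
        by (intro commute_mult_left[symmetric]) auto
      have IH: "conjugate G x v' = inv v'" by (rule Suc.IH[OF v'D v'1 v'M])
      have v_eq: "v = v' \<otimes> u'" using vc u'M by (simp add: v'_def m_assoc)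
      have "conjugate G x v = inv v' \<otimes> inv u'"
        using IH M(4)[OF u'M] v'D u'M x by (simp add: v_eq conj_mult)
      also have "\<dots> = inv (u' \<otimes> v')" using v'D u'M by (simp add: inv_mult_group)
      also have "u' \<otimes> v' = v" using v'M[OF u'M] v_eq by simp
      finally show ?thesis .
    qed
  qed
  then show ?thesis using y M(3) by blast
qed

text \<open>Both \<open>x\<close> and \<open>b x\<close> lie outside \<open>D\<close> and invert
  \<open>a\<close>, so \<open>b\<close> centralizes \<open>a\<close>.\<close>

lemma two_elements_commute:
  assumes a: "a \<in> D" "a [^] (2 ^ k :: nat) = \<one>" and b: "b \<in> D"
  shows "a \<otimes> b = b \<otimes> a"
proof -
  obtain x where x: "x \<in> carrier G" "x \<notin> D" by (rule exists_not_in_D)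
  have "b \<otimes> x \<notin> D"
  proof
    assume "b \<otimes> x \<in> D"
    then have "inv b \<otimes> (b \<otimes> x) \<in> D" by (rule D_mult[OF D_inv[OF b]])
    moreover have "inv b \<otimes> (b \<otimes> x) = x" using b x by (intro inv_cancel_left) auto
    ultimately show False using x by simp
  qed
  then have "conjugate G (b \<otimes> x) a = inv a" using a b x by (intro two_element_inverted) auto
  also have "inv a = conjugate G x a" using a x by (intro two_element_inverted[symmetric]) auto
  finally have "conjugate G x (conjugate G b a) = conjugate G x a" using a b x by (simp add: conj_conj)
  then have "conjugate G b a = a" using a b x by simp
  then show ?thesis using a b by (simp add: conj_fix_iff)
qed

section \<open>Elements of odd order in \<open>D\<close> commute\<close>

lemma inv_eq_pow:
  assumes x: "x \<in> carrier G"
  obtains k :: nat where "inv x = x [^] k"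
proof -
  have "Suc (ord x - 1) = ord x" using ord_nonzero[OF x] by simp
  then have "x [^] (ord x - 1) \<otimes> x = \<one>" using x by (metis nat_pow_Suc pow_ord_eq_1)
  then have "inv x = x [^] (ord x - 1)" using x by (intro inv_equality) auto
  then show thesis using that by blast
qed

lemma commutator_pow:
  assumes y: "y \<in> D" and g: "g \<in> carrier G"
  obtains n :: nat where "inv y \<otimes> conjugate G g y = y [^] n"
proof -
  obtain k :: nat where k: "inv y = y [^] k" by (rule inv_eq_pow[OF D_closed[OF y]])
  obtain n :: nat where n: "conjugate G g y = y [^] n" by (rule D_conj[OF y g])
  show thesis using that[of "k + n"] k n y by (simp add: nat_pow_mult)
qed

text \<open>The commutator \<open>[y,w]\<close> is the inverse of \<open>[w,y]\<close>, which is a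
  power of \<open>w\<close>.\<close>

lemma commutator_pow_right:
  assumes y: "y \<in> carrier G" and w: "w \<in> D"
  obtains n :: nat where "inv y \<otimes> conjugate G w y = w [^] n"
proof -
  obtain n :: nat where n: "inv w \<otimes> conjugate G y w = w [^] n" by (rule commutator_pow[OF w y])
  have "inv y \<otimes> conjugate G w y = inv (inv w \<otimes> conjugate G y w)"
    using y w by (simp add: conjugate_def inv_mult_group m_assoc)
  moreover obtain k :: nat where "inv (w [^] n) = (w [^] n) [^] k" by (rule inv_eq_pow[OF nat_pow_closed[OF D_closed[OF w]]])
  ultimately show thesis using that[of "n * k"] n w by (simp add: nat_pow_pow)
qed

text \<open>For noncommuting \<open>y\<close> and \<open>w\<close> of minimal orders the commutator generates the unique subgroup
  of prime order of both cyclic groups; since \<open>p\<close> is odd, a suitable \<open>w y\<^sup>-\<^sup>e\<close> then has smaller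
  order than \<open>w\<close> and the same commutator with \<open>y\<close>.\<close>

lemma odd_elements_commute_step:
  assumes y: "y \<in> D" "odd (ord y)" and w: "w \<in> D" "odd (ord w)" and le: "ord w \<le> ord y"
    and IH: "\<And>y' w'. y' \<in> D \<Longrightarrow> w' \<in> D \<Longrightarrow> odd (ord y') \<Longrightarrow> odd (ord w') \<Longrightarrow>
      ord y' + ord w' < ord y + ord w \<Longrightarrow> y' \<otimes> w' = w' \<otimes> y'"
  shows "y \<otimes> w = w \<otimes> y"
proof (rule ccontr)
  assume nc: "y \<otimes> w \<noteq> w \<otimes> y"
  have yc: "y \<in> carrier G" and wc: "w \<in> carrier G" using y w by auto
  define c where "c = inv y \<otimes> conjugate G w y"
  have cc: "c \<in> carrier G" using yc wc by (simp add: c_def)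
  have conj_wy: "conjugate G w y = y \<otimes> c" using yc wc by (simp add: c_def)
  \<comment> \<open>Being a power of both \<open>w\<close> and \<open>y\<close>, the commutator
    \<open>c\<close> commutes with both, so \<open>[y^m, w^n] = c^(n m)\<close>.\<close>
  obtain i where ci: "c = w [^] (i::nat)" unfolding c_def by (rule commutator_pow_right[OF yc w(1)])
  obtain j where cj: "c = y [^] (j::nat)" unfolding c_def by (rule commutator_pow[OF y(1) wc])
  have cw: "c \<otimes> w = w \<otimes> c" using ci wc by (simp add: group_commutes_pow)
  have cy: "c \<otimes> y = y \<otimes> c" using cj yc by (simp add: group_commutes_pow)
  have c1: "c \<noteq> \<one>" using nc conj_wy yc wc by (auto simp: conj_fix_iff)
  have conj_c: "conjugate G (w [^] n) c = c" for n :: nat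
    using cw wc cc group_commutes_pow[OF cw[symmetric] wc cc] by (simp add: conj_fix_iff)
  have conj_pow_w: "conjugate G (w [^] n) y = y \<otimes> c [^] n" for n :: nat
  proof (induction n)
    case 0
    then show ?case using yc by simp
  next
    case (Suc n)
    have "conjugate G (w [^] Suc n) y = conjugate G w (conjugate G (w [^] n) y)" using wc yc by (simp add: conj_conj)
    also have "\<dots> = y \<otimes> (c \<otimes> c [^] n)"
      using Suc wc yc cc conj_wy conj_c[of 1] by (simp add: conj_mult conj_pow m_assoc)
    also have "c \<otimes> c [^] n = c [^] Suc n" using cc by (simp only: nat_pow_Suc2)
    finally show ?case .
  qed
  have conj_pow_wy: "conjugate G (w [^] n) (y [^] m) = y [^] m \<otimes> c [^] (n * m)" for n m :: nat
  proof -
    have "conjugate G (w [^] n) (y [^] m) = (y \<otimes> c [^] n) [^] m" using wc yc by (simp add: conj_pow conj_pow_w)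
    also have "\<dots> = y [^] m \<otimes> (c [^] n) [^] m"
      using yc cc group_commutes_pow[OF cy cc yc, of n] by (intro pow_mult_distrib) auto
    finally show ?thesis using cc by (simp add: nat_pow_pow)
  qed
  have smaller: "ord (v [^] q) < ord v" "odd (ord (v [^] q))" if "v \<in> D" "odd (ord v)" "prime q" "q dvd ord v" for v q
  proof -
    have "ord (v [^] q) = ord v div q" using that prime_gt_0_nat[of q] by (intro ord_pow) auto
    moreover have "ord v \<noteq> 0" using that by simp
    ultimately show "ord (v [^] q) < ord v" using prime_gt_1_nat[OF that(3)] by (simp add: div_less_dividend)
    show "odd (ord (v [^] q))" using ord_pow_dvd[of v q] that dvd_trans by blast
  qed
  \<comment> \<open>By the induction hypothesis \<open>w^q\<close>, of smaller order, commutes with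
    \<open>y\<close>.\<close>
  have w_prime: "c [^] q = \<one>" if q: "prime q" "q dvd ord w" for q :: nat
  proof -
    have "y \<otimes> w [^] q = w [^] q \<otimes> y"
      using smaller[OF w q] y w by (intro IH D_pow) auto
    then have "conjugate G (w [^] q) y = y" using yc wc by (subst conj_fix_iff) auto
    then have "y \<otimes> c [^] q = y" using conj_pow_w[of q] by simp
    then show ?thesis using yc cc by (simp add: l_cancel_one)
  qed
  have y_prime: "c [^] q = \<one>" if q: "prime q" "q dvd ord y" for q :: nat
  proof -
    have "y [^] q \<otimes> w = w \<otimes> y [^] q"
      using smaller[OF y q] y w by (intro IH D_pow) auto
    then have "conjugate G w (y [^] q) = y [^] q" using yc wc by (simp add: conj_fix_iff)
    then have "y [^] q \<otimes> c [^] q = y [^] q" using conj_pow_wy[of 1 q] wc by simp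
    then show ?thesis using yc cc by (simp add: l_cancel_one)
  qed
  have "w \<noteq> \<one>" using nc yc by auto
  then have "ord w \<noteq> 1" using wc ord_eq_1 by blast
  then obtain p where p: "prime p" "p dvd ord w" using prime_factor_nat by blast
  have cp: "c [^] p = \<one>" by (rule w_prime[OF p])
  have uniq: "q = p" if "prime q" "c [^] q = \<one>" for q :: nat
    using prime_eq_of_pow_eq_one[OF cc c1 that p(1) cp] .
  obtain b where b: "ord w = p ^ b"
    using prime_power_of_unique_prime[OF ord_nonzero[OF wc] p(1)] uniq w_prime by metis
  obtain a where a: "ord y = p ^ a"
    using prime_power_of_unique_prime[OF ord_nonzero[OF yc] p(1)] uniq y_prime by metis
  have p1: "1 < p" using p prime_gt_1_nat by blast
  have "b \<noteq> 0" using b \<open>ord w \<noteq> 1\<close> by (intro notI) simp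
  then obtain b' where b': "b = Suc b'" by (cases b) auto
  have "b \<le> a" using le a b p1 by simp
  then obtain e where e: "a = e + b" by (metis le_Suc_ex add.commute)
  define a' where "a' = e + b'"
  have a': "a = Suc a'" using e b' by (simp add: a'_def)
  \<comment> \<open>As \<open>c\<close> has order \<open>p\<close>, it lies in the subgroup of order
    \<open>p\<close> of the cyclic \<open>p\<close>-group generated by \<open>v\<close>.\<close>
  have root: "\<exists>i'. n = p ^ k * i' \<and> \<not> p dvd i'"
    if v: "v \<in> carrier G" "ord v = p ^ Suc k" "c = v [^] n" for v k n
  proof -
    have "v [^] (n * p) = \<one>" using cp v by (simp add: nat_pow_pow)
    then have "p ^ Suc k dvd n * p" using v by (simp add: pow_eq_id)
    then have "p ^ k dvd n" using p1 by (simp add: mult.commute)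
    then obtain i' where i': "n = p ^ k * i'" by auto
    have "\<not> p dvd i'"
    proof
      assume "p dvd i'"
      then have "p ^ Suc k dvd n" using i' by (auto simp: mult_ac)
      then have "c = \<one>" using v by (metis pow_eq_id)
      then show False using c1 by simp
    qed
    with i' show ?thesis by blast
  qed
  obtain i' where i': "i = p ^ b' * i'" "\<not> p dvd i'" using root[OF wc _ ci] b b' by blast
  obtain j' where j': "j = p ^ a' * j'" "\<not> p dvd j'" using root[OF yc _ cj] a a' by blast
  \<comment> \<open>Absorbing the factors prime to \<open>p\<close> makes \<open>c\<close> both the
    \<open>p^b'\<close>-th power of \<open>w1\<close> and the \<open>p^a'\<close>-th power of
    \<open>y1\<close>; the new commutator \<open>c'\<close> is still nontrivial.\<close>
  define w1 where "w1 = w [^] i'"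
  define y1 where "y1 = y [^] j'"
  have w1: "w1 \<in> D" "w1 \<in> carrier G" "c = w1 [^] (p ^ b')"
    using w(1) wc ci i' by (simp_all add: w1_def D_pow nat_pow_pow mult.commute)
  have y1: "y1 \<in> D" "y1 \<in> carrier G" "c = y1 [^] (p ^ a')"
    using y(1) yc cj j' by (simp_all add: y1_def D_pow nat_pow_pow mult.commute)
  define c' where "c' = c [^] (i' * j')"
  have c'c: "c' \<in> carrier G" using cc by (simp add: c'_def)
  have c'1: "c' \<noteq> \<one>"
  proof
    assume "c' = \<one>"
    moreover have "coprime (i' * j') p"
      using i' j' p by (metis coprime_commute prime_dvd_mult_iff prime_imp_coprime)
    ultimately show False using pow_eq_one_of_coprime[OF cc _ cp] c1 unfolding c'_def by blast
  qed
  have y1w1: "conjugate G w1 y1 = y1 \<otimes> c'" by (simp add: w1_def y1_def conj_pow_wy c'_def)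
  have b'_pos: "b' \<noteq> 0"
  proof
    assume "b' = 0"
    then have "w1 = c" using w1 by simp
    then have "conjugate G w1 y1 = y1"
      using cy cc yc group_commutes_pow[OF cy[symmetric] yc cc] by (simp add: y1_def conj_fix_iff)
    then show False using y1w1 y1 c'c c'1 by (simp add: l_cancel_one')
  qed
  \<comment> \<open>Since \<open>a' = e + b'\<close>, the \<open>p^b'\<close>-th power of
    \<open>z\<close> is the inverse of \<open>c\<close> and cancels that of \<open>w1\<close>, up to
    a power of the commutator \<open>d\<close>.\<close>
  define z where "z = inv y1 [^] (p ^ e)"
  define w' where "w' = w1 \<otimes> z"
  have zD: "z \<in> D" "z \<in> carrier G" using y1 by (simp_all add: z_def D_inv D_pow)
  have z_y1: "z \<otimes> y1 = y1 \<otimes> z"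
    unfolding z_def using y1 by (intro group_commutes_pow) auto
  have c'w1: "c' \<otimes> w1 = w1 \<otimes> c'"
    unfolding c'_def w1_def using cw cc wc group_commutes_pow[OF cw[symmetric] wc cc]
    by (intro group_commutes_pow) auto
  have c'y1: "c' \<otimes> y1 = y1 \<otimes> c'"
    unfolding c'_def y1_def using cy cc yc group_commutes_pow[OF cy[symmetric] yc cc]
    by (intro group_commutes_pow) auto
  have y1_c': "inv y1 \<otimes> c' = c' \<otimes> inv y1" using y1 c'c c'y1 by (intro commute_inv_left) simp_all
  have iy1_ic': "inv c' \<otimes> inv y1 = inv y1 \<otimes> inv c'"
    using y1 c'c y1_c' by (intro commute_inv_left) simp_all
  have "conjugate G w1 (inv y1) = inv (c' \<otimes> y1)" using y1w1 y1 w1 c'y1 by (simp only: conj_inv)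
  also have "\<dots> = inv y1 \<otimes> inv c'" using y1 c'c by (intro inv_mult_group)
  finally have "conjugate G w1 (inv y1) = inv y1 \<otimes> inv c'" .
  then have "conjugate G w1 z = (inv y1 \<otimes> inv c') [^] (p ^ e)"
    using y1 w1 by (simp add: z_def conj_pow)
  also have "\<dots> = z \<otimes> inv c' [^] (p ^ e)"
    unfolding z_def using y1 c'c by (intro pow_mult_distrib iy1_ic'[symmetric]) simp_all
  finally have zw: "conjugate G w1 z = z \<otimes> inv c' [^] (p ^ e)" .
  define d where "d = inv c' [^] (p ^ e)"
  have dc: "d \<in> carrier G" using c'c by (simp add: d_def)
  have dw: "d \<otimes> w1 = w1 \<otimes> d"
    unfolding d_def using c'w1 c'c w1 by (intro group_commutes_pow commute_inv_left) auto
  have "d \<otimes> y1 = y1 \<otimes> d"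
    unfolding d_def using c'y1 c'c y1 by (intro group_commutes_pow commute_inv_left) auto
  then have "inv y1 \<otimes> d = d \<otimes> inv y1" using y1 dc by (intro commute_inv_left) auto
  then have dz: "d \<otimes> z = z \<otimes> d"
    unfolding z_def using y1 dc by (intro group_commutes_pow[symmetric]) auto
  have dp: "d [^] p = \<one>"
  proof -
    have "c' [^] p = \<one>" unfolding c'_def by (rule pow_pow_eq_one[OF cc cp])
    then have "inv c' [^] p = \<one>" using c'c by (simp add: nat_pow_inv)
    then show ?thesis unfolding d_def using c'c by (intro pow_pow_eq_one) simp_all
  qed
  have "z \<otimes> w1 = w1 \<otimes> (z \<otimes> d)" using zw zD w1 dc by (simp add: conj_eq_iff d_def)
  then have "z \<otimes> w1 = w1 \<otimes> z \<otimes> d" using zD w1 dc by (simp add: m_assoc)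
  then have "w' [^] (p ^ b') = w1 [^] (p ^ b') \<otimes> z [^] (p ^ b') \<otimes> d [^] (\<Sum>i<p ^ b'. i)"
    unfolding w'_def using w1 zD dc dw dz by (intro class_two_pow_mult) auto
  moreover have "d [^] (\<Sum>i<p ^ b'. i) = \<one>"
  proof -
    \<comment> \<open>Oddness makes the exponent of \<open>d\<close> a multiple of
      \<open>p^b'\<close>, hence of \<open>p\<close>.\<close>
    have "odd p" using p w(2) by (meson dvd_trans)
    then have "p ^ b' dvd (\<Sum>i<p ^ b'. i)" by (intro odd_dvd_sum_lessThan) simp
    then have "p dvd (\<Sum>i<p ^ b'. i)" using b'_pos by (meson dvd_power dvd_trans neq0_conv)
    then show ?thesis using dp dc by (metis dvdE nat_pow_one nat_pow_pow)
  qed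
  moreover have "z [^] (p ^ b') = inv c"
  proof -
    have "z [^] (p ^ b') = inv y1 [^] (p ^ a')"
      using y1 by (simp add: z_def nat_pow_pow a'_def power_add)
    then show ?thesis using y1 by (simp add: nat_pow_inv)
  qed
  ultimately have w'_one: "w' [^] (p ^ b') = \<one>" using w1(3)[symmetric] cc by simp
  have w'D: "w' \<in> D" "w' \<in> carrier G" using w1 zD by (simp_all add: w'_def D_mult)
  have dvd: "ord w' dvd p ^ b'" using w'_one w'D by (simp add: pow_eq_id)
  then have "ord w' \<le> p ^ b'" using p1 by (intro dvd_imp_le) auto
  also have "\<dots> < ord w" using p1 by (simp add: b b')
  finally have less: "ord w' < ord w" .
  have "p ^ b' dvd ord w" by (simp add: b b')
  then have odd_w': "odd (ord w')" using w(2) dvd dvd_trans by blast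
  have "ord y1 dvd ord y" using ord_pow_dvd yc by (simp add: y1_def)
  then have y1_ord: "ord y1 \<le> ord y" "odd (ord y1)"
    using y(2) ord_nonzero[OF yc] dvd_trans dvd_imp_le[of "ord y1" "ord y"] by blast+
  have "y1 \<otimes> w' = w' \<otimes> y1" using y1 w'D y1_ord odd_w' less by (intro IH) auto
  \<comment> \<open>As \<open>z\<close> is a power of the inverse of \<open>y1\<close>, also
    \<open>w1\<close> commutes with \<open>y1\<close>, contrary to the nontriviality of
    \<open>c'\<close>.\<close>
  then have "w' \<otimes> inv z \<otimes> y1 = y1 \<otimes> (w' \<otimes> inv z)"
    using z_y1 zD y1 w'D by (intro commute_mult_left commute_inv_left) auto
  moreover have "w' \<otimes> inv z = w1" using w1 zD by (simp add: w'_def m_assoc)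
  ultimately have "conjugate G w1 y1 = y1" using w1 y1 by (simp add: conj_fix_iff)
  then show False using y1w1 y1 c'c c'1 by (simp add: l_cancel_one')
qed

lemma odd_elements_commute:
  assumes "y \<in> D" "odd (ord y)" "w \<in> D" "odd (ord w)"
  shows "y \<otimes> w = w \<otimes> y"
  using assms
proof (induction "ord y + ord w" arbitrary: y w rule: less_induct)
  case less
  show ?case
  proof (cases "ord w \<le> ord y")
    case True
    show ?thesis
      by (rule odd_elements_commute_step[OF less.prems(1,2,3,4) True]) (use less.hyps in blast)
  next
    case False
    then have le: "ord y \<le> ord w" by simp
    have "w \<otimes> y = y \<otimes> w"
      by (rule odd_elements_commute_step[OF less.prems(3,4,1,2) le])
        (use less.hyps in \<open>simp add: add.commute\<close>)
    then show ?thesis by simp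
  qed
qed

end

section \<open>Extensions of an abelian group by an inverting element\<close>

text \<open>Over a finite field finite dimension means finiteness: the whole space spans itself, and
  a finite set has finitely many linear combinations.\<close>

lemma finite_rank_iff:
  assumes "prime p" "comm_group A" "p_group p A"
  shows "finite_rank p A \<longleftrightarrow> finite (carrier (omega_module p A))"
proof -
  interpret V: vectorspace "residue_ring (int p)" "omega_module p A"
    using assms by (rule vectorspace_omega_module)
  show ?thesis
  proof
    assume "finite (carrier (omega_module p A))"
    moreover have "V.span (carrier (omega_module p A)) = carrier (omega_module p A)"
      using V.span_is_subset2[of "carrier (omega_module p A)"] V.in_own_span[of "carrier (omega_module p A)"]
      by auto
    ultimately show "finite_rank p A" unfolding finite_rank_def V.fin_dim_def by blast
  next
    assume "finite_rank p A"
    then obtain S where S: "finite S" "S \<subseteq> carrier (omega_module p A)"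
      "V.span S = carrier (omega_module p A)"
      unfolding finite_rank_def V.fin_dim_def by blast
    \<comment> \<open>Coefficient functions are made extensional so that there are only finitely
      many of them.\<close>
    let ?F = "S \<rightarrow>\<^sub>E carrier (residue_ring (int p))"
    have "V.span S \<subseteq> (\<lambda>a. V.lincomb a S) ` ?F"
    proof
      fix v assume "v \<in> V.span S"
      then obtain a where a: "a \<in> S \<rightarrow> carrier (residue_ring (int p))" "v = V.lincomb a S"
        using V.finite_span[OF S(1,2)] by auto
      have "V.lincomb (restrict a S) S = V.lincomb a S"
        using a S by (intro V.lincomb_cong) auto
      then show "v \<in> (\<lambda>a. V.lincomb a S) ` ?F" using a by (intro image_eqI[of _ _ "restrict a S"]) auto
    qed
    moreover have "finite ?F" using S(1) by (intro finite_PiE) (auto simp: residue_ring_def)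
    ultimately have "finite (V.span S)" by (rule finite_subset[OF _ finite_imageI])
    then show "finite (carrier (omega_module p A))" by (simp only: S(3))
  qed
qed

lemma (in group) carrier_omega_module_two:
  assumes A: "subgroup A G"
  shows "carrier (omega_module 2 (G\<lparr>carrier := A\<rparr>)) = {a \<in> A. a [^] (2::nat) = \<one>}"
proof -
  have "ord a \<noteq> 0 \<and> ord a \<le> 2 \<longleftrightarrow> ord a dvd 2" for a
  proof
    assume "ord a \<noteq> 0 \<and> ord a \<le> 2"
    then have "ord a = 1 \<or> ord a = 2" by linarith
    then show "ord a dvd 2" by auto
  next
    assume "ord a dvd 2"
    then show "ord a \<noteq> 0 \<and> ord a \<le> 2" using dvd_imp_le[of "ord a" 2] by (auto intro: Nat.gr0I)
  qed
  note * = this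
  have "carrier (omega_module 2 (G\<lparr>carrier := A\<rparr>)) = {a \<in> A. ord a \<noteq> 0 \<and> ord a \<le> 2}"
    using A by (auto simp: omega_module_def ord_consistent)
  also have "\<dots> = {a \<in> A. ord a dvd 2}" by (simp only: *)
  also have "\<dots> = {a \<in> A. a [^] (2::nat) = \<one>}"
    using A by (auto simp: pow_eq_id subgroup.mem_carrier)
  finally show ?thesis .
qed

locale inversion_extension = group G for G (structure) +
  fixes A g
  assumes A_subgroup: "subgroup A G" and g_closed [simp]: "g \<in> carrier G"
    and g_square: "g [^] (2::nat) \<in> A" and conj_g: "a \<in> A \<Longrightarrow> conjugate G g a = inv a"
begin

sublocale A: subgroup A G by (rule A_subgroup)

text \<open>Conjugation by \<open>g\<close> is multiplicative, so inversion on \<open>A\<close> is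
  multiplicative as well.\<close>

lemma A_comm:
  assumes "a \<in> A" "b \<in> A"
  shows "a \<otimes> b = b \<otimes> a"
proof -
  have "inv (b \<otimes> a) = inv a \<otimes> inv b" using assms by (simp add: inv_mult_group)
  also have "\<dots> = conjugate G g (a \<otimes> b)" using assms by (simp add: conj_g conj_mult del: A.m_closed)
  also have "\<dots> = inv (a \<otimes> b)" using assms by (intro conj_g) simp
  finally have "inv (inv (b \<otimes> a)) = inv (inv (a \<otimes> b))" by simp
  then show ?thesis using assms by simp
qed

lemma A_g: "a \<in> A \<Longrightarrow> a \<otimes> g = g \<otimes> inv a"
  using conj_g[of a] by (simp add: conj_eq_iff)

text \<open>The element \<open>g^2\<close> of \<open>A\<close> is inverted by \<open>g\<close> and
  also commutes with it.\<close>

lemma g_fourth: "(g [^] (2::nat)) [^] (2::nat) = \<one>"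
proof -
  have "inv (g [^] (2::nat)) = conjugate G g (g [^] (2::nat))" using g_square by (simp add: conj_g)
  also have "\<dots> = g [^] (2::nat)" using group_commutes_pow[of g g 2] by (subst conj_fix_iff) auto
  finally have "inv (g [^] (2::nat)) = g [^] (2::nat)" .
  then have "g [^] (2::nat) \<otimes> g [^] (2::nat) = \<one>" using r_inv[of "g [^] (2::nat)"] by simp
  then show ?thesis using pow_two[of "g [^] (2::nat)"] by simp
qed

text \<open>An explicit form of the subgroup generated by \<open>g\<close> and \<open>A\<close>, by
  \<open>generate_eq_P\<close>; both cosets coincide if \<open>g\<close> lies in
  \<open>A\<close>.\<close>

definition P where "P = A \<union> (\<lambda>a. g \<otimes> a) ` A"

lemma A_gA: "a \<in> A \<Longrightarrow> b \<in> A \<Longrightarrow> a \<otimes> (g \<otimes> b) = g \<otimes> (inv a \<otimes> b)"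
  using A_g[of a] by (simp flip: m_assoc)

lemma gA_A: "a \<in> A \<Longrightarrow> b \<in> A \<Longrightarrow> g \<otimes> a \<otimes> b = g \<otimes> (a \<otimes> b)"
  by (simp add: m_assoc)

lemma gA_gA: "a \<in> A \<Longrightarrow> b \<in> A \<Longrightarrow> g \<otimes> a \<otimes> (g \<otimes> b) = g [^] (2::nat) \<otimes> (inv a \<otimes> b)"
  using A_gA[of a b] by (simp add: m_assoc pow_two)

lemma inv_gA:
  assumes "a \<in> A"
  shows "inv (g \<otimes> a) = g \<otimes> (inv (g [^] (2::nat)) \<otimes> a)"
proof (rule inv_equality)
  let ?s = "g [^] (2::nat)"
  have "g \<otimes> (inv ?s \<otimes> a) \<otimes> (g \<otimes> a) = ?s \<otimes> (inv (inv ?s \<otimes> a) \<otimes> a)"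
    using assms g_square by (intro gA_gA) auto
  also have "\<dots> = ?s \<otimes> (inv a \<otimes> ?s \<otimes> a)" using assms g_square by (simp add: inv_mult_group)
  also have "inv a \<otimes> ?s = ?s \<otimes> inv a" using assms g_square by (intro A_comm) auto
  also have "?s \<otimes> (?s \<otimes> inv a \<otimes> a) = \<one>"
    using assms g_square g_fourth pow_two[of ?s] by (simp add: m_assoc)
  finally show "g \<otimes> (inv ?s \<otimes> a) \<otimes> (g \<otimes> a) = \<one>" .
qed (use assms g_square in auto)

lemma P_subgroup: "subgroup P G"
proof (rule subgroupI)
  show "P \<subseteq> carrier G" by (auto simp: P_def)
  have "\<one> \<in> P" by (simp add: P_def)
  then show "P \<noteq> {}" by blast
  show "inv x \<in> P" if "x \<in> P" for x
    using that g_square by (auto simp: P_def inv_gA)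
  show "x \<otimes> y \<in> P" if "x \<in> P" "y \<in> P" for x y
    using that g_square by (auto simp: P_def A_gA gA_gA gA_A)
qed

lemma generate_eq_P: "generate G (insert g A) = P"
proof
  have "g \<in> P" using A.one_closed by (auto simp: P_def image_iff intro!: bexI[of _ \<one>])
  then show "generate G (insert g A) \<subseteq> P"
    by (intro generate_subgroup_incl P_subgroup) (auto simp: P_def)
  have "g \<otimes> a \<in> generate G (insert g A)" if "a \<in> A" for a
    using that by (intro generate.eng generate.incl) auto
  then show "P \<subseteq> generate G (insert g A)"
    by (auto simp: P_def intro: generate.incl)
qed

lemma conj_gA:
  assumes "a \<in> A" "b \<in> A"
  shows "conjugate G (g \<otimes> b) a = inv a"
proof -
  have "conjugate G (g \<otimes> b) a = conjugate G b (inv a)" using assms by (simp add: conj_g flip: conj_conj)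
  also have "\<dots> = inv a" using assms A_comm[of "inv a" b] by (subst conj_fix_iff) auto
  finally show ?thesis .
qed

lemma conj_A: "a \<in> A \<Longrightarrow> b \<in> A \<Longrightarrow> conjugate G b a = a"
  using A_comm[of a b] by (subst conj_fix_iff) auto

lemma commutator_P_A:
  assumes "a \<in> A" "p \<in> P"
  shows "inv a \<otimes> conjugate G p a = \<one> \<or> inv a \<otimes> conjugate G p a = inv (a [^] (2::nat))"
  using assms by (auto simp: P_def conj_A conj_gA pow_two inv_mult_group)

lemma conj_A_gA:
  assumes "a \<in> A" "b \<in> A"
  shows "conjugate G b (g \<otimes> a) = g \<otimes> a \<otimes> b [^] (2::nat)"
proof -
  have "conjugate G b (g \<otimes> a) = g \<otimes> (b \<otimes> a \<otimes> b)"
    using assms A_gA[of "inv b" a] by (simp add: conjugate_def m_assoc)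
  also have "b \<otimes> a = a \<otimes> b" using assms by (intro A_comm)
  finally show ?thesis using assms by (simp add: m_assoc pow_two)
qed

lemma commutator_P_gA:
  assumes "a \<in> A" "b \<in> A"
  shows "inv (g \<otimes> a) \<otimes> conjugate G b (g \<otimes> a) = b [^] (2::nat)"
    and "inv (g \<otimes> a) \<otimes> conjugate G (g \<otimes> b) (g \<otimes> a) = inv (a [^] (2::nat)) \<otimes> b [^] (2::nat)"
proof -
  show "inv (g \<otimes> a) \<otimes> conjugate G b (g \<otimes> a) = b [^] (2::nat)"
    using assms by (simp add: conj_A_gA m_assoc inv_mult_group)
  have "conjugate G g (g \<otimes> a) = g \<otimes> inv a" using assms conj_g[of a] conj_fix_iff[of g g] by (simp add: conj_mult)
  then have "conjugate G (g \<otimes> b) (g \<otimes> a) = conjugate G b (g \<otimes> inv a)"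
    using assms by (simp flip: conj_conj)
  then show "inv (g \<otimes> a) \<otimes> conjugate G (g \<otimes> b) (g \<otimes> a) = inv (a [^] (2::nat)) \<otimes> b [^] (2::nat)"
    using assms by (simp add: conj_A_gA m_assoc inv_mult_group pow_two)
qed

lemma gA_fourth: "a \<in> A \<Longrightarrow> (g \<otimes> a) [^] (2 ^ 2 :: nat) = \<one>"
proof -
  assume a: "a \<in> A"
  have "(g \<otimes> a) [^] (2::nat) = g [^] (2::nat)" using a gA_gA[of a a] by (simp add: pow_two)
  then have "((g \<otimes> a) [^] (2::nat)) [^] (2::nat) = \<one>" using g_fourth by simp
  then show ?thesis using a by (simp add: nat_pow_pow)
qed

text \<open>An element of \<open>A\<close> that commutes with \<open>g b\<close> is also inverted by
  it, so its square is trivial. The rest of the centralizer is contained in the translate of these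
  elements by \<open>g b\<close>.\<close>

lemma finite_centralizer_gA:
  assumes fin: "finite {a \<in> A. a [^] (2::nat) = \<one>}" and b: "b \<in> A"
  shows "finite (P \<inter> centralizer G (g \<otimes> b))"
proof -
  let ?T = "{a \<in> A. a [^] (2::nat) = \<one>}"
  have torsion: "a \<in> ?T" if a: "a \<in> A" "a \<otimes> (g \<otimes> b) = g \<otimes> b \<otimes> a" for a
  proof -
    have "inv a = a" using a b conj_gA[of a b] conj_fix_iff[of "g \<otimes> b" a] by simp
    then have "a \<otimes> a = a \<otimes> inv a" by simp
    then show ?thesis using a by (simp add: pow_two)
  qed
  have "P \<inter> centralizer G (g \<otimes> b) \<subseteq> ?T \<union> (\<lambda>a. g \<otimes> b \<otimes> a) ` ?T"
  proof
    fix x assume x: "x \<in> P \<inter> centralizer G (g \<otimes> b)"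
    then have xc: "x \<otimes> (g \<otimes> b) = g \<otimes> b \<otimes> x" by (simp add: centralizer_iff)
    show "x \<in> ?T \<union> (\<lambda>a. g \<otimes> b \<otimes> a) ` ?T"
    proof (cases "x \<in> A")
      case True
      then show ?thesis using torsion xc by blast
    next
      case False
      then obtain a where a: "a \<in> A" "x = g \<otimes> a" using x by (auto simp: P_def)
      define c where "c = inv b \<otimes> a"
      have c: "c \<in> A" "x = g \<otimes> b \<otimes> c" using a b by (simp_all add: c_def m_assoc)
      then have "g \<otimes> b \<otimes> (c \<otimes> (g \<otimes> b)) = g \<otimes> b \<otimes> (g \<otimes> b \<otimes> c)"
        using xc b by (simp add: m_assoc)
      then have "c \<otimes> (g \<otimes> b) = g \<otimes> b \<otimes> c" using b c by (simp del: m_assoc)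
      then show ?thesis using torsion[of c] c by blast
    qed
  qed
  then show ?thesis using fin finite_subset by blast
qed

end

section \<open>The converse: the product of \<open>P\<close> and \<open>Q\<close>\<close>

locale inversion_product = inversion_extension +
  fixes Q
  assumes periodic: "periodic_group G"
    and product: "internal_direct_product G P Q"
    and P_two: "p_group 2 (G\<lparr>carrier := P\<rparr>)"
    and finite_involutions: "finite {a \<in> A. a [^] (2::nat) = \<one>}"
    and finite_Q: "finite Q" and comm_Q: "comm_group (G\<lparr>carrier := Q\<rparr>)"
    and odd_Q: "odd_order_group (G\<lparr>carrier := Q\<rparr>)"
begin

lemma P_normal: "P \<lhd> G" and Q_normal: "Q \<lhd> G" and P_Int_Q: "P \<inter> Q = {\<one>}"
  and P_mult_Q: "P <#> Q = carrier G"
  using product by (auto simp: internal_direct_product_def)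

sublocale Q: subgroup Q G
  using Q_normal by (simp add: normal_imp_subgroup)

lemma P_closed [simp]: "p \<in> P \<Longrightarrow> p \<in> carrier G"
  using P_subgroup by (rule subgroup.mem_carrier)

lemma A_P [simp]: "a \<in> A \<Longrightarrow> a \<in> P"
  by (simp add: P_def)

lemma Q_comm: "q \<in> Q \<Longrightarrow> r \<in> Q \<Longrightarrow> q \<otimes> r = r \<otimes> q"
  using comm_monoid.m_comm[OF comm_group.axioms(1)[OF comm_Q]] by simp

lemma Q_odd:
  assumes "q \<in> Q"
  shows "odd (ord q)"
  using odd_Q assms ord_consistent[OF Q.subgroup_axioms] by (auto simp: odd_order_group_def)

lemma A_two:
  assumes "a \<in> A"
  obtains k :: nat where "a [^] (2 ^ k :: nat) = \<one>"
proof -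
  have "a \<in> carrier (G\<lparr>carrier := P\<rparr>)" using assms by simp
  then obtain k where "group.ord (G\<lparr>carrier := P\<rparr>) a = 2 ^ k"
    using P_two unfolding p_group_def by blast
  then have "ord a = 2 ^ k" using ord_consistent[OF P_subgroup] assms by simp
  then show thesis using that[of k] pow_ord_eq_1[of a] assms by simp
qed

text \<open>The commutator lies in both normal subgroups, hence in their trivial
  intersection.\<close>

lemma P_Q_comm:
  assumes p: "p \<in> P" and q: "q \<in> Q"
  shows "p \<otimes> q = q \<otimes> p"
proof -
  have c: "p \<in> carrier G" "q \<in> carrier G" using p q by auto
  have "inv q \<otimes> p \<otimes> q \<in> P" using normal.inv_op_closed1[OF P_normal c(2) p] .
  then have 1: "inv p \<otimes> (inv q \<otimes> p \<otimes> q) \<in> P"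
    by (rule subgroup.m_closed[OF P_subgroup subgroup.m_inv_closed[OF P_subgroup p]])
  have "inv p \<otimes> inv q \<otimes> p \<in> Q" using normal.inv_op_closed1[OF Q_normal c(1), of "inv q"] q by simp
  then have "inv p \<otimes> inv q \<otimes> p \<otimes> q \<in> Q" using q by simp
  also have "inv p \<otimes> inv q \<otimes> p \<otimes> q = inv p \<otimes> (inv q \<otimes> p \<otimes> q)" using c by (simp add: m_assoc)
  finally have "inv p \<otimes> (inv q \<otimes> p \<otimes> q) = \<one>" using 1 P_Int_Q by blast
  then have "conjugate G q p = p" using c by (simp add: conjugate_def inv_solve_left')
  then show ?thesis using c by (simp add: conj_fix_iff)
qed

lemma decompose:
  assumes "x \<in> carrier G"
  obtains p q where "p \<in> P" "q \<in> Q" "x = p \<otimes> q"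
proof -
  have "x \<in> P <#> Q" using assms P_mult_Q by simp
  then show thesis using that by (auto simp: set_mult_def)
qed

lemma conj_product:
  assumes "p \<in> P" "q \<in> Q" "r \<in> P" "s \<in> Q"
  shows "conjugate G (r \<otimes> s) (p \<otimes> q) = conjugate G r p \<otimes> q"
proof -
  have c: "p \<in> carrier G" "q \<in> carrier G" "r \<in> carrier G" "s \<in> carrier G" using assms by auto
  have "conjugate G r q = q" using P_Q_comm[of r q] assms c by (subst conj_fix_iff) auto
  moreover have "conjugate G s q = q" using Q_comm[of s q] assms c by (subst conj_fix_iff) auto
  moreover have "conjugate G r p \<in> P"
    using normal.inv_op_closed1[OF P_normal c(3) assms(1)] by (simp add: conjugate_def)
  then have "conjugate G s (conjugate G r p) = conjugate G r p"
    using P_Q_comm[of "conjugate G r p" s] assms c by (subst conj_fix_iff) auto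
  ultimately show ?thesis using c by (simp add: conj_mult flip: conj_conj)
qed

text \<open>The only conjugates of \<open>a q\<close> are itself and \<open>a^-1 q\<close>, and the
  latter is a power of \<open>a q\<close> because the orders of \<open>a\<close> and
  \<open>q\<close> are coprime.\<close>

lemma A_mult_Q_cyclic_normal:
  assumes a: "a \<in> A" and q: "q \<in> Q"
  shows "a \<otimes> q \<in> cyclic_normals G"
proof -
  have c: "a \<in> carrier G" "q \<in> carrier G" using a q by auto
  obtain k where k: "a [^] (2 ^ k :: nat) = \<one>" by (rule A_two[OF a])
  have cop: "coprime (2 ^ k) (ord q)" using Q_odd[OF q] by simp
  \<comment> \<open>This exponent inverts \<open>a\<close> and fixes \<open>q\<close>.\<close>
  obtain n where n: "[n = 2 ^ k - 1] (mod 2 ^ k)" "[n = 1] (mod ord q)"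
    using binary_chinese_remainder_nat[OF cop] by blast
  have "a [^] n = a [^] (2 ^ k - 1 :: nat)" by (rule pow_cong[OF c(1) k n(1)])
  moreover have "a [^] (2 ^ k - 1 :: nat) \<otimes> a = \<one>"
    using k by (metis Suc_pred' nat_pow_Suc zero_less_power pos2)
  ultimately have "inv a = a [^] n" using c by (simp add: inv_equality)
  moreover have "q [^] n = q"
    using pow_cong[OF c(2) pow_ord_eq_1[OF c(2)] n(2)] c by simp
  moreover have "(a \<otimes> q) [^] n = a [^] n \<otimes> q [^] n"
    using c P_Q_comm[of a q] a q by (intro pow_mult_distrib) auto
  ultimately have pow: "(a \<otimes> q) [^] n = inv a \<otimes> q" by simp
  show ?thesis
    unfolding cyclic_normals_def
  proof (intro CollectI conjI ballI)
    show "a \<otimes> q \<in> carrier G" using c by simp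
    fix h assume "h \<in> carrier G"
    then obtain r s where h: "r \<in> P" "s \<in> Q" "h = r \<otimes> s" by (rule decompose)
    then have conj: "conjugate G h (a \<otimes> q) = conjugate G r a \<otimes> q" using a q by (simp add: conj_product)
    show "\<exists>n::nat. conjugate G h (a \<otimes> q) = (a \<otimes> q) [^] n"
    proof (cases "r \<in> A")
      case True
      then have "conjugate G h (a \<otimes> q) = (a \<otimes> q) [^] (1::nat)" using conj conj_A a c by simp
      then show ?thesis by blast
    next
      case False
      then obtain b where "b \<in> A" "r = g \<otimes> b" using h by (auto simp: P_def)
      then have "conjugate G h (a \<otimes> q) = (a \<otimes> q) [^] n" using conj conj_gA[OF a] pow by simp
      then show ?thesis by blast
    qed
  qed
qed

text \<open>An \<open>x\<close> outside \<open>cyclic_normals\<close> has a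
  \<open>P\<close>-component \<open>g b\<close>. The \<open>P\<close>-component of anything
  centralizing \<open>x\<close> centralizes \<open>g b\<close>, and \<open>Q\<close> is
  finite.\<close>

lemma FCI_group_product: "FCI_group G"
  unfolding FCI_group_iff[OF periodic]
proof
  fix x assume x: "x \<in> carrier G - cyclic_normals G"
  then obtain p q where pq: "p \<in> P" "q \<in> Q" "x = p \<otimes> q" by (metis DiffD1 decompose)
  then have "p \<notin> A" using x A_mult_Q_cyclic_normal by blast
  then obtain b where b: "b \<in> A" "p = g \<otimes> b" using pq by (auto simp: P_def)
  have "centralizer G x \<subseteq> (\<lambda>(r, s). r \<otimes> s) ` ((P \<inter> centralizer G p) \<times> Q)"
  proof
    fix h assume h: "h \<in> centralizer G x"
    then have "h \<in> carrier G" by (simp add: centralizer_iff)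
    then obtain r s where rs: "r \<in> P" "s \<in> Q" "h = r \<otimes> s" by (rule decompose)
    have "conjugate G h x = x" using h pq by (simp add: centralizer_iff conj_fix_iff)
    then have "conjugate G r p \<otimes> q = p \<otimes> q" using pq rs by (simp add: conj_product)
    then have "conjugate G r p = p" using pq rs by simp
    then have "r \<in> centralizer G p" using pq rs by (simp add: conj_fix_iff centralizer_iff)
    then show "h \<in> (\<lambda>(r, s). r \<otimes> s) ` ((P \<inter> centralizer G p) \<times> Q)" using rs by auto
  qed
  moreover have "finite ((\<lambda>(r, s). r \<otimes> s) ` ((P \<inter> centralizer G p) \<times> Q))"
    using finite_centralizer_gA[OF finite_involutions b(1)] finite_Q b by simp
  ultimately show "finite (centralizer G x)" by (rule finite_subset)
qed

section \<open>Local nilpotency of the product\<close>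

definition torsion :: "nat \<Rightarrow> 'a set" where
  "torsion m = {a \<in> A. a [^] (2 ^ m :: nat) = \<one>}"

lemma torsion_subset: "torsion m \<subseteq> A"
  by (auto simp: torsion_def)

lemma torsion_subgroup: "subgroup (torsion m) G"
proof (rule subgroupI)
  show "torsion m \<subseteq> carrier G" using torsion_subset A.subset by (rule subset_trans)
  have "\<one> \<in> torsion m" by (simp add: torsion_def)
  then show "torsion m \<noteq> {}" by blast
  show "inv a \<in> torsion m" if "a \<in> torsion m" for a
    using that by (simp add: torsion_def nat_pow_inv)
  show "a \<otimes> b \<in> torsion m" if "a \<in> torsion m" "b \<in> torsion m" for a b
    using that A_comm[of a b] by (simp add: torsion_def pow_mult_distrib)
qed

lemma square_torsion: "a \<in> torsion m \<Longrightarrow> a [^] (2::nat) \<in> torsion (m - 1)"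
  using subgroup_pow_closed[OF A_subgroup, of a 2]
  by (cases m) (auto simp: torsion_def nat_pow_pow)

lemma torsion_zero: "torsion 0 = {\<one>}"
  by (auto simp: torsion_def)

text \<open>The commutators of \<open>g\<close> with \<open>A\<close> are squares, so the lower central series descends through
  the subgroups \<open>torsion m\<close>.\<close>

definition descend :: "nat \<Rightarrow> nat \<Rightarrow> 'a set" where
  "descend m n = (case n of 0 \<Rightarrow> {p \<otimes> q | p q. p \<in> torsion m \<union> (\<lambda>a. g \<otimes> a) ` torsion m \<and> q \<in> Q}
     | Suc i \<Rightarrow> torsion (m - 1 - i))"

text \<open>For positive \<open>m\<close> the element \<open>g^2\<close>, whose square is trivial,
  lies in \<open>torsion m\<close>. So the description of \<open>P\<close> applies with
  \<open>torsion m\<close> in place of \<open>A\<close>.\<close>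

lemma torsion_extension:
  assumes "m \<noteq> 0"
  shows "inversion_extension G (torsion m) g"
proof (intro inversion_extension.intro inversion_extension_axioms.intro group_axioms)
  show "subgroup (torsion m) G" by (rule torsion_subgroup)
  have "(g [^] (2::nat)) [^] (2 ^ m :: nat) = \<one>"
    using two_power_pow_mono[of "g [^] (2::nat)" 1 m] g_fourth assms by simp
  then show "g [^] (2::nat) \<in> torsion m" using g_square by (simp add: torsion_def)
qed (auto simp: torsion_def conj_g)

lemma descend_subgroup:
  assumes m: "m \<noteq> 0"
  shows "subgroup (descend m n) G"
proof (cases n)
  case (Suc i)
  then show ?thesis by (simp add: descend_def torsion_subgroup)
next
  case 0
  interpret T: inversion_extension G "torsion m" g using m by (rule torsion_extension)
  have TP: "T.P \<subseteq> P" using torsion_subset by (auto simp: T.P_def P_def)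
  have eq: "descend m n = {p \<otimes> q | p q. p \<in> T.P \<and> q \<in> Q}" by (simp add: 0 descend_def T.P_def)
  show ?thesis
    unfolding eq
  proof (rule subgroupI)
    show "{p \<otimes> q | p q. p \<in> T.P \<and> q \<in> Q} \<subseteq> carrier G" using TP by auto
    have "\<one> \<otimes> \<one> \<in> {p \<otimes> q | p q. p \<in> T.P \<and> q \<in> Q}"
      using subgroup.one_closed[OF T.P_subgroup] Q.one_closed by blast
    then show "{p \<otimes> q | p q. p \<in> T.P \<and> q \<in> Q} \<noteq> {}" by blast
    show "inv x \<in> {p \<otimes> q | p q. p \<in> T.P \<and> q \<in> Q}" if x: "x \<in> {p \<otimes> q | p q. p \<in> T.P \<and> q \<in> Q}" for x
    proof -
      obtain p q where pq: "p \<in> T.P" "q \<in> Q" "x = p \<otimes> q" using x by blast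
      then have pP: "p \<in> P" using TP by blast
      have "inv x = inv p \<otimes> inv q" using pq pP P_Q_comm[OF pP pq(2)] by (simp add: inv_mult_group)
      moreover have "inv p \<in> T.P" "inv q \<in> Q" using pq subgroup.m_inv_closed[OF T.P_subgroup] by auto
      ultimately show ?thesis by blast
    qed
    show "x \<otimes> y \<in> {p \<otimes> q | p q. p \<in> T.P \<and> q \<in> Q}"
      if x: "x \<in> {p \<otimes> q | p q. p \<in> T.P \<and> q \<in> Q}" and y: "y \<in> {p \<otimes> q | p q. p \<in> T.P \<and> q \<in> Q}" for x y
    proof -
      obtain p q where pq: "p \<in> T.P" "q \<in> Q" "x = p \<otimes> q" using x by blast
      obtain r s where rs: "r \<in> T.P" "s \<in> Q" "y = r \<otimes> s" using y by blast
      have PP: "p \<in> P" "r \<in> P" using pq rs TP by auto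
      have "x \<otimes> y = p \<otimes> (q \<otimes> r) \<otimes> s" using pq rs PP by (simp add: m_assoc)
      also have "q \<otimes> r = r \<otimes> q" using P_Q_comm[OF PP(2) pq(2)] by simp
      finally have "x \<otimes> y = (p \<otimes> r) \<otimes> (q \<otimes> s)" using pq rs PP by (simp add: m_assoc)
      moreover have "p \<otimes> r \<in> T.P" "q \<otimes> s \<in> Q"
        using pq rs subgroup.m_closed[OF T.P_subgroup] by auto
      ultimately show ?thesis by blast
    qed
  qed
qed

text \<open>The components in \<open>Q\<close> cancel. Commutators inside the extension of
  \<open>torsion m\<close> by \<open>g\<close> are products of squares and inverse squares, and
  squaring lowers the torsion exponent by one.\<close>

lemma descend_commutator:
  assumes m: "m \<noteq> 0" and x: "x \<in> descend m n" and y: "y \<in> descend m 0"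
  shows "inv x \<otimes> conjugate G y x \<in> descend m (Suc n)"
proof -
  have T_P: "torsion m \<union> (\<lambda>a. g \<otimes> a) ` torsion m \<subseteq> P" using torsion_subset by (auto simp: P_def)
  obtain r s where rs: "r \<in> torsion m \<union> (\<lambda>a. g \<otimes> a) ` torsion m" "s \<in> Q" "y = r \<otimes> s"
    using y by (auto simp: descend_def)
  then have rP: "r \<in> P" using T_P by blast
  show ?thesis
  proof (cases n)
    case 0
    then obtain p q where pq: "p \<in> torsion m \<union> (\<lambda>a. g \<otimes> a) ` torsion m" "q \<in> Q" "x = p \<otimes> q"
      using x by (auto simp: descend_def)
    then have pP: "p \<in> P" using T_P by blast
    have "inv x = inv q \<otimes> inv p" using pq pP by (simp add: inv_mult_group)
    also have "\<dots> = inv p \<otimes> inv q"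
      using P_Q_comm[of "inv p" "inv q"] pP pq subgroup.m_inv_closed[OF P_subgroup pP] by simp
    finally have "inv x \<otimes> conjugate G y x = inv p \<otimes> (inv q \<otimes> (conjugate G r p \<otimes> q))"
      using pq rs pP rP by (simp add: conj_product m_assoc)
    also have "conjugate G r p \<otimes> q = q \<otimes> conjugate G r p"
      using normal.inv_op_closed1[OF P_normal _ pP, of r] rP pq by (intro P_Q_comm) (auto simp: conjugate_def)
    finally have eq: "inv x \<otimes> conjugate G y x = inv p \<otimes> conjugate G r p" using pq pP rP by simp
    have sq: "a [^] (2::nat) \<in> torsion (m - 1)" "inv (a [^] (2::nat)) \<in> torsion (m - 1)" if "a \<in> torsion m" for a
      using square_torsion[OF that] subgroup.m_inv_closed[OF torsion_subgroup] by blast+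
    have "inv p \<otimes> conjugate G r p \<in> torsion (m - 1)"
    proof (cases "p \<in> torsion m")
      case True
      then have "p \<in> A" using torsion_subset by blast
      then show ?thesis
        using commutator_P_A[OF _ rP] sq(2)[OF True] subgroup.one_closed[OF torsion_subgroup] by metis
    next
      case False
      then obtain a where a: "a \<in> torsion m" "p = g \<otimes> a" using pq(1) by blast
      then have aA: "a \<in> A" using torsion_subset by blast
      show ?thesis
      proof (cases "r \<in> torsion m")
        case True
        then have "r \<in> A" using torsion_subset by blast
        then show ?thesis using commutator_P_gA(1)[OF aA] sq(1)[OF True] a by simp
      next
        case False
        then obtain b where b: "b \<in> torsion m" "r = g \<otimes> b" using rs(1) by blast
        then have "b \<in> A" using torsion_subset by blast
        then show ?thesis
          using commutator_P_gA(2)[OF aA] a b sq subgroup.m_closed[OF torsion_subgroup] by simp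
      qed
    qed
    then show ?thesis using eq 0 by (simp add: descend_def)
  next
    case (Suc i)
    then have xT: "x \<in> torsion (m - 1 - i)" using x by (simp add: descend_def)
    then have xA: "x \<in> A" using torsion_subset by blast
    have "conjugate G y x = conjugate G r x" using conj_product[of x \<one> r s] xA rP rs by simp
    moreover have "inv x \<otimes> conjugate G r x \<in> torsion (m - 1 - i - 1)"
      using commutator_P_A[OF xA rP] square_torsion[OF xT] subgroup.m_inv_closed[OF torsion_subgroup]
        subgroup.one_closed[OF torsion_subgroup] by metis
    ultimately show ?thesis by (simp add: Suc descend_def)
  qed
qed

text \<open>A finite set involves only finitely many elements of \<open>A\<close>, so it lies in
  \<open>descend m 0\<close> for some \<open>m\<close>, and \<open>descend m m\<close> is
  trivial.\<close>

lemma locally_nilpotent_product: "locally_nilpotent_group G"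
  unfolding locally_nilpotent_group_def
proof (intro conjI allI impI)
  fix S assume S: "finite S \<and> S \<subseteq> carrier G"
  have "\<exists>k. s \<in> descend k 0" if s: "s \<in> S" for s
  proof -
    obtain p q where pq: "p \<in> P" "q \<in> Q" "s = p \<otimes> q" using S s by (meson decompose subsetD)
    then obtain a where a: "a \<in> A" "p = a \<or> p = g \<otimes> a" by (auto simp: P_def)
    obtain k where "a [^] (2 ^ k :: nat) = \<one>" by (rule A_two[OF a(1)])
    then have "a \<in> torsion k" using a by (simp add: torsion_def)
    then have "s \<in> descend k 0" using a(2) pq by (auto simp: descend_def)
    then show ?thesis by blast
  qed
  then obtain k where k: "\<And>s. s \<in> S \<Longrightarrow> s \<in> descend (k s) 0" by metis
  \<comment> \<open>The successor makes \<open>m\<close> positive, as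
    \<open>descend_subgroup\<close> requires; inserting 0 covers empty \<open>S\<close>.\<close>
  define m where "m = Suc (Max (insert 0 (k ` S)))"
  have m0: "m \<noteq> 0" by (simp add: m_def)
  have "descend i 0 \<subseteq> descend j 0" if "i \<le> j" for i j
  proof -
    have "torsion i \<subseteq> torsion j" using that two_power_pow_mono by (auto simp: torsion_def)
    then show ?thesis by (auto simp: descend_def)
  qed
  moreover have "k s \<le> m" if "s \<in> S" for s using S that by (auto simp: m_def le_SucI)
  ultimately have SD: "S \<subseteq> descend m 0" using k by blast
  define H where "H = generate G S"
  have H: "subgroup H G" "H \<subseteq> descend m 0"
    using S SD descend_subgroup[OF m0] by (auto simp: H_def generate_is_subgroup dest: generate_subgroup_incl)
  interpret H: group "G\<lparr>carrier := H\<rparr>" using H(1) by (rule subgroup.subgroup_is_group) simp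
  have "lower_central (G\<lparr>carrier := H\<rparr>) m \<subseteq> descend m m"
    using H by (intro lower_central_subset descend_subgroup[OF m0] descend_commutator[OF m0]) auto
  also have "descend m m = {\<one>}" using m0 by (cases m) (auto simp: descend_def torsion_zero)
  finally have "lower_central (G\<lparr>carrier := H\<rparr>) m = {\<one>}"
    using subgroup.one_closed[OF H.lower_central_subgroup[of m]] by auto
  then show "nilpotent_group (G\<lparr>carrier := generate G S\<rparr>)"
    using H.is_group by (auto simp: nilpotent_group_def H_def)
qed simp

end

section \<open>The structure theorem\<close>

context infinite_FCI_group
begin

definition two_part where "two_part = {a \<in> D. \<exists>k. a [^] (2 ^ k :: nat) = \<one>}"

definition odd_part_D where "odd_part_D = {q \<in> D. odd (ord q)}"

lemma two_part_subgroup: "subgroup two_part G"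
proof (rule subgroupI)
  show "two_part \<subseteq> carrier G" by (auto simp: two_part_def)
  have "\<one> \<in> two_part" by (simp add: two_part_def)
  then show "two_part \<noteq> {}" by blast
  show "inv a \<in> two_part" if "a \<in> two_part" for a
    using that by (auto simp: two_part_def D_inv nat_pow_inv)
  show "a \<otimes> b \<in> two_part" if ab: "a \<in> two_part" "b \<in> two_part" for a b
  proof -
    obtain k l where kl: "a [^] (2 ^ k :: nat) = \<one>" "b [^] (2 ^ l :: nat) = \<one>" and abD: "a \<in> D" "b \<in> D"
      using ab by (auto simp: two_part_def)
    have "(a \<otimes> b) [^] (2 ^ (k + l) :: nat) = a [^] (2 ^ (k + l) :: nat) \<otimes> b [^] (2 ^ (k + l) :: nat)"
      using two_elements_commute[OF abD(1) kl(1) abD(2)] abD by (intro pow_mult_distrib) auto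
    also have "\<dots> = \<one>"
      using two_power_pow_mono[OF _ kl(1), of "k + l"] two_power_pow_mono[OF _ kl(2), of "k + l"] abD by simp
    finally show ?thesis using abD by (auto simp: two_part_def D_mult)
  qed
qed

lemma odd_part_D_subgroup: "subgroup odd_part_D G"
proof (rule subgroupI)
  show "odd_part_D \<subseteq> carrier G" by (auto simp: odd_part_D_def)
  have "\<one> \<in> odd_part_D" by (simp add: odd_part_D_def)
  then show "odd_part_D \<noteq> {}" by blast
  show "inv a \<in> odd_part_D" if "a \<in> odd_part_D" for a
    using that by (auto simp: odd_part_D_def D_inv)
  show "a \<otimes> b \<in> odd_part_D" if ab: "a \<in> odd_part_D" "b \<in> odd_part_D" for a b
  proof -
    have abD: "a \<in> D" "b \<in> D" "odd (ord a)" "odd (ord b)" using ab by (auto simp: odd_part_D_def)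
    have "ord (a \<otimes> b) dvd ord a * ord b"
      using odd_elements_commute[of a b] abD by (intro ord_mul_divides) auto
    moreover have "odd (ord a * ord b)" using abD by simp
    ultimately have "odd (ord (a \<otimes> b))" using dvd_trans by blast
    then show ?thesis using abD by (simp add: odd_part_D_def D_mult)
  qed
qed

lemma odd_part_D_normal: "odd_part_D \<lhd> G"
  unfolding normal_inv_iff
proof (intro conjI ballI odd_part_D_subgroup)
  fix x q assume x: "x \<in> carrier G" and q: "q \<in> odd_part_D"
  have "conjugate G (inv x) q \<in> odd_part_D"
    using x q by (intro subgroup_conj_closed odd_part_D_subgroup) (auto simp: odd_part_D_def)
  then show "x \<otimes> q \<otimes> inv x \<in> odd_part_D" using x by (simp add: conjugate_def)
qed

lemma decompose_D:
  assumes "y \<in> D"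
  obtains a q where "a \<in> two_part" "q \<in> odd_part_D" "y = a \<otimes> q"
proof -
  have yc: "y \<in> carrier G" using assms by simp
  obtain i j k m :: nat where y: "y = y [^] i \<otimes> y [^] j" "(y [^] i) [^] (2 ^ k :: nat) = \<one>"
    "odd m" "(y [^] j) [^] m = \<one>"
    by (rule power_part_decomposition[OF yc ord_nonzero[OF yc]])
  have "y [^] i \<in> two_part" using y(2) D_pow[OF assms] by (auto simp: two_part_def)
  moreover have "ord (y [^] j) dvd m" using y(4) yc by (simp add: pow_eq_id)
  then have "y [^] j \<in> odd_part_D" using y(3) D_pow[OF assms] dvd_trans by (auto simp: odd_part_D_def)
  ultimately show thesis using that y(1) by blast
qed

text \<open>The odd part of any \<open>x\<close> outside \<open>D\<close> is a power of its own
  square and so lies in \<open>D\<close>; hence the 2-part of \<open>x\<close> is outside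
  \<open>D\<close>.\<close>

lemma exists_inverting_two_element:
  obtains g k where "g \<in> carrier G" "g \<notin> D" "g [^] (2 ^ k :: nat) = \<one>"
proof -
  obtain x where x: "x \<in> carrier G" "x \<notin> D" by (rule exists_not_in_D)
  obtain i j k m :: nat where ij: "x = x [^] i \<otimes> x [^] j" "(x [^] i) [^] (2 ^ k :: nat) = \<one>"
    "odd m" "(x [^] j) [^] m = \<one>"
    by (rule power_part_decomposition[OF x(1) ord_nonzero[OF x(1)]])
  define q where "q = x [^] j"
  have qc: "q \<in> carrier G" using x by (simp add: q_def)
  obtain t where t: "m = 2 * t + 1" using ij(3) by (rule oddE)
  have "q [^] (2 * Suc t) = q [^] (m + 1)" by (simp add: t)
  also have "\<dots> = q" using ij(4) qc by (simp add: q_def)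
  finally have "(q [^] (2::nat)) [^] Suc t = q" using qc by (simp only: nat_pow_pow)
  then have qD: "q \<in> D" using D_pow[OF square_in_D[OF qc], of "Suc t"] by simp
  have "x [^] i \<notin> D" using D_mult[OF _ qD] x(2) ij(1) unfolding q_def by metis
  then show thesis using that ij(2) x by blast
qed

text \<open>The square of \<open>g\<close> commutes with \<open>q\<close>, so \<open>g\<close>
  inverts \<open>y = [q,g]\<close> and \<open>[y,g] = y^-2\<close>. As \<open>y\<close> has odd
  order it is a power of \<open>[y,g]\<close>, and local nilpotency gives
  \<open>y = 1\<close>.\<close>

lemma odd_part_D_commutes:
  assumes q: "q \<in> odd_part_D" and g: "g \<in> carrier G" and g2: "g [^] (2 ^ k :: nat) = \<one>"
  shows "g \<otimes> q = q \<otimes> g"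
proof -
  have qD: "q \<in> D" and qc: "q \<in> carrier G" and qo: "odd (ord q)" using q by (auto simp: odd_part_D_def)
  have "(g [^] (2::nat)) [^] (2 ^ k :: nat) = \<one>" by (rule pow_pow_eq_one[OF g g2])
  then have "g [^] (2::nat) \<otimes> q = q \<otimes> g [^] (2::nat)"
    using two_elements_commute[OF square_in_D[OF g] _ qD] by blast
  then have gg: "conjugate G g (conjugate G g q) = q"
    using g qc conj_fix_iff[of "g [^] (2::nat)" q] by (simp add: conj_conj pow_two)
  define y where "y = inv q \<otimes> conjugate G g q"
  have yc: "y \<in> carrier G" using qc g by (simp add: y_def)
  have "y \<in> odd_part_D"
    unfolding y_def using odd_part_D_subgroup q qD g
    by (intro subgroup.m_closed subgroup.m_inv_closed subgroup_conj_closed)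
  then have "odd (ord y)" by (simp add: odd_part_D_def)
  then obtain t where t: "ord y = 2 * t + 1" by (rule oddE)
  have "conjugate G g y = inv y"
    using qc g gg by (simp add: y_def conj_mult conj_inv inv_mult_group)
  then have "(inv y \<otimes> conjugate G g y) [^] t = (inv y [^] (2::nat)) [^] t" using yc by (simp add: pow_two)
  also have "\<dots> = inv (y [^] (2 * t))" using yc by (simp only: nat_pow_pow nat_pow_inv inv_closed nat_pow_closed)
  also have "\<dots> = y"
  proof -
    have "y \<otimes> y [^] (2 * t) = y [^] Suc (2 * t)" using yc by (simp only: nat_pow_Suc2)
    also have "\<dots> = \<one>" using t yc pow_ord_eq_1[of y] by simp
    finally show ?thesis using yc by (simp add: inv_equality)
  qed
  finally have "y = \<one>"
    using locally_nilpotent_commutator_generates[OF locally_nilpotent yc g, of t] by simp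
  then have "conjugate G g q = q" using qc g by (simp add: y_def inv_solve_left')
  then show ?thesis using qc g by (simp add: conj_fix_iff)
qed

text \<open>The witnesses are the 2-part of \<open>D\<close> for \<open>A\<close>, the odd part of
  \<open>D\<close> for \<open>Q\<close>, and a 2-element outside \<open>D\<close> for
  \<open>g\<close>.\<close>

theorem structure_of_infinite_FCI_group:
  obtains P Q g A where "internal_direct_product G P Q" "inversion_extension G A g"
    "P = generate G (insert g A)" "p_group 2 (G\<lparr>carrier := P\<rparr>)" "infinite A"
    "comm_group (G\<lparr>carrier := A\<rparr>)" "finite_rank 2 (G\<lparr>carrier := A\<rparr>)"
    "ord g \<noteq> 0" "ord g \<le> 4" "finite Q" "comm_group (G\<lparr>carrier := Q\<rparr>)"
    "odd_order_group (G\<lparr>carrier := Q\<rparr>)"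
proof -
  obtain g k where g: "g \<in> carrier G" "g \<notin> D" "g [^] (2 ^ k :: nat) = \<one>"
    by (rule exists_inverting_two_element)
  interpret E: inversion_extension G two_part g
  proof (intro inversion_extension.intro inversion_extension_axioms.intro group_axioms two_part_subgroup g(1))
    show "g [^] (2::nat) \<in> two_part"
      using square_in_D[OF g(1)] pow_pow_eq_one[OF g(1,3)] by (auto simp: two_part_def)
    show "conjugate G g a = inv a" if "a \<in> two_part" for a
      using that two_element_inverted[OF g(1,2)] by (auto simp: two_part_def)
  qed
  interpret Q: subgroup odd_part_D G by (rule odd_part_D_subgroup)
  have P_two: "\<exists>k. x [^] (2 ^ k :: nat) = \<one>" if "x \<in> E.P" for x
    using that unfolding E.P_def
  proof (elim UnE imageE)
    show "\<exists>k. x [^] (2 ^ k :: nat) = \<one>" if "x \<in> two_part" using that by (simp add: two_part_def)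
    show "\<exists>k. x [^] (2 ^ k :: nat) = \<one>" if "x = g \<otimes> a" "a \<in> two_part" for a
      using E.gA_fourth[OF that(2)] that(1) by blast
  qed
  have P_carr: "E.P \<subseteq> carrier G" using E.P_subgroup by (rule subgroup.subset)
  have PQ: "p \<otimes> q = q \<otimes> p" if p: "p \<in> E.P" and q: "q \<in> odd_part_D" for p q
    using odd_part_D_commutes[OF q] P_two[OF p] P_carr p by blast
  have decompose: "\<exists>p\<in>E.P. \<exists>q\<in>odd_part_D. x = p \<otimes> q" if x: "x \<in> carrier G" for x
  proof (cases "x \<in> D")
    case True
    then obtain a q where "a \<in> two_part" "q \<in> odd_part_D" "x = a \<otimes> q" by (rule decompose_D)
    then show ?thesis by (auto simp: E.P_def)
  next
    case False
    \<comment> \<open>As \<open>D\<close> has index 2, an \<open>x\<close> outside \<open>D\<close>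
      lies in the coset \<open>g D\<close>.\<close>
    have "inv g \<notin> D" using D_inv[of "inv g"] g by auto
    then have "inv g \<otimes> x \<in> D" using False x g by (intro mult_in_D) auto
    then obtain a q where aq: "a \<in> two_part" "q \<in> odd_part_D" "inv g \<otimes> x = a \<otimes> q" by (rule decompose_D)
    then have "x = g \<otimes> (a \<otimes> q)" using x g by (metis cancel_inv_left)
    then have "x = (g \<otimes> a) \<otimes> q" using aq g by (simp add: m_assoc)
    moreover have "g \<otimes> a \<in> E.P" using aq by (simp add: E.P_def)
    ultimately show ?thesis using aq by blast
  qed
  have P_normal: "E.P \<lhd> G"
    unfolding normal_inv_iff
  proof (intro conjI ballI E.P_subgroup)
    fix x p assume x: "x \<in> carrier G" and p: "p \<in> E.P"
    obtain r q where rq: "r \<in> E.P" "q \<in> odd_part_D" "x = r \<otimes> q" using decompose[OF x] by blast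
    have c: "r \<in> carrier G" "p \<in> carrier G" "q \<in> carrier G" using rq p P_carr by auto
    have "x \<otimes> p \<otimes> inv x = r \<otimes> (q \<otimes> p) \<otimes> (inv q \<otimes> inv r)"
      using c by (simp add: rq(3) inv_mult_group m_assoc)
    also have "q \<otimes> p = p \<otimes> q" using PQ[OF p rq(2)] by simp
    finally have "x \<otimes> p \<otimes> inv x = r \<otimes> p \<otimes> inv r" using c by (simp add: m_assoc)
    then show "x \<otimes> p \<otimes> inv x \<in> E.P"
      using rq p E.P_subgroup by (simp add: subgroup.m_closed subgroup.m_inv_closed)
  qed
  have ord_P: "\<exists>k. ord x = 2 ^ k" if x: "x \<in> E.P" for x
  proof -
    obtain k where "x [^] (2 ^ k :: nat) = \<one>" using P_two[OF x] by blast
    then have "ord x dvd 2 ^ k" using x P_carr pow_eq_id by blast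
    then show ?thesis using divides_primepow_nat[OF two_is_prime_nat] by blast
  qed
  have "E.P \<inter> odd_part_D = {\<one>}"
  proof -
    have "x = \<one>" if x: "x \<in> E.P" "x \<in> odd_part_D" for x
    proof -
      obtain k where k: "ord x = 2 ^ k" using ord_P[OF x(1)] by blast
      have "odd (ord x)" using x by (simp add: odd_part_D_def)
      then have "ord x = 1" using k by (cases k) auto
      then show ?thesis using x ord_eq_1 Q.mem_carrier by blast
    qed
    then show ?thesis using subgroup.one_closed[OF E.P_subgroup] Q.one_closed by blast
  qed
  moreover have "E.P <#> odd_part_D = carrier G"
    using decompose P_carr Q.subset by (auto simp: set_mult_def)
  ultimately have product: "internal_direct_product G E.P odd_part_D"
    using P_normal odd_part_D_normal by (simp add: internal_direct_product_def)
  \<comment> \<open>Finiteness of \<open>Q\<close> comes from the finite centralizer of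
    \<open>g\<close>; since \<open>D\<close> is infinite, its other factor \<open>A\<close> is
    infinite.\<close>
  have "odd_part_D \<subseteq> centralizer G g"
    using odd_part_D_commutes[OF _ g(1,3)] by (auto simp: centralizer_iff)
  then have finite_Q: "finite odd_part_D" using finite_centralizer[OF g(1,2)] finite_subset by blast
  have infinite_A: "infinite two_part"
  proof
    assume "finite two_part"
    moreover have "D \<subseteq> (\<lambda>(a, q). a \<otimes> q) ` (two_part \<times> odd_part_D)"
    proof
      fix y assume "y \<in> D"
      then obtain a q where "a \<in> two_part" "q \<in> odd_part_D" "y = a \<otimes> q" by (rule decompose_D)
      then show "y \<in> (\<lambda>(a, q). a \<otimes> q) ` (two_part \<times> odd_part_D)" by auto
    qed
    ultimately show False using finite_Q infinite_D finite_subset by blast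
  qed
  have comm_A: "comm_group (G\<lparr>carrier := two_part\<rparr>)"
    using E.A_comm two_part_subgroup
    by (intro group.group_comm_groupI subgroup.subgroup_is_group) auto
  have comm_Q: "comm_group (G\<lparr>carrier := odd_part_D\<rparr>)"
    using odd_elements_commute odd_part_D_subgroup
    by (intro group.group_comm_groupI subgroup.subgroup_is_group) (auto simp: odd_part_D_def)
  have P_group: "p_group 2 (G\<lparr>carrier := E.P\<rparr>)"
    using ord_P E.P_subgroup by (auto simp: p_group_def ord_consistent subgroup.subgroup_is_group)
  have A_group: "p_group 2 (G\<lparr>carrier := two_part\<rparr>)"
    using ord_P two_part_subgroup by (auto simp: p_group_def ord_consistent subgroup.subgroup_is_group E.P_def)
  have "two_part \<subseteq> D" by (auto simp: two_part_def)
  then have "finite {a \<in> two_part. a [^] (2::nat) = \<one>}"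
    by (intro finite_torsion two_part_subgroup E.A_comm) simp_all
  then have rank: "finite_rank 2 (G\<lparr>carrier := two_part\<rparr>)"
    by (subst finite_rank_iff[OF two_is_prime_nat comm_A A_group])
      (simp add: carrier_omega_module_two two_part_subgroup)
  have odd: "odd_order_group (G\<lparr>carrier := odd_part_D\<rparr>)"
    using odd_part_D_subgroup
    by (auto simp: odd_order_group_def periodic_group_def ord_consistent subgroup.subgroup_is_group)
      (auto simp: odd_part_D_def)
  have "g [^] (4::nat) = \<one>" using E.g_fourth by (simp add: nat_pow_pow)
  then have "ord g dvd 4" using pow_eq_id by simp
  then have "ord g \<le> 4" by (rule dvd_imp_le) simp
  then show thesis
    using that[OF product E.inversion_extension_axioms E.generate_eq_P[symmetric] P_group infinite_A comm_A rank]
      finite_Q comm_Q odd g by simp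
qed

end

theorem theorem3p2:
  fixes G :: "('a, 'b) monoid_scheme" (structure)
  assumes "group G"
    and "\<not> Dedekind_group G"
    and "infinite (carrier G)"
    and "periodic_group G"
  shows "locally_nilpotent_group G \<and> FCI_group G \<longleftrightarrow>
    (\<exists>P Q. internal_direct_product G P Q \<and>
      (\<exists>g A. g \<in> carrier G \<and> subgroup A G \<and>
         P = generate G (insert g A) \<and>
         p_group 2 (G\<lparr>carrier := P\<rparr>) \<and>
         infinite A \<and> comm_group (G\<lparr>carrier := A\<rparr>) \<and>
         finite_rank 2 (G\<lparr>carrier := A\<rparr>) \<and>
         group.ord G g \<noteq> 0 \<and> group.ord G g \<le> 4 \<and>
         g [^] (2::nat) \<in> A \<and>
         (\<forall>a\<in>A. inv g \<otimes> a \<otimes> g = inv a)) \<and>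
      finite Q \<and> comm_group (G\<lparr>carrier := Q\<rparr>) \<and>
      odd_order_group (G\<lparr>carrier := Q\<rparr>))"
  (is "?L \<longleftrightarrow> ?R")
proof
  interpret group G by fact
  assume ?L
  then interpret infinite_FCI_group G
    using assms by (intro infinite_FCI_group.intro infinite_FCI_group_axioms.intro) auto
  obtain P Q g A where *: "internal_direct_product G P Q" "inversion_extension G A g"
    "P = generate G (insert g A)" "p_group 2 (G\<lparr>carrier := P\<rparr>)" "infinite A"
    "comm_group (G\<lparr>carrier := A\<rparr>)" "finite_rank 2 (G\<lparr>carrier := A\<rparr>)"
    "ord g \<noteq> 0" "ord g \<le> 4" "finite Q" "comm_group (G\<lparr>carrier := Q\<rparr>)"
    "odd_order_group (G\<lparr>carrier := Q\<rparr>)"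
    by (rule structure_of_infinite_FCI_group)
  interpret E: inversion_extension G A g by fact
  have "\<forall>a\<in>A. inv g \<otimes> a \<otimes> g = inv a" using E.conj_g by (simp add: conjugate_def)
  then show ?R using * E.g_closed E.A_subgroup E.g_square by blast
next
  interpret group G by fact
  assume ?R
  then obtain P Q g A where *: "internal_direct_product G P Q" "g \<in> carrier G" "subgroup A G"
    "P = generate G (insert g A)" "p_group 2 (G\<lparr>carrier := P\<rparr>)"
    "comm_group (G\<lparr>carrier := A\<rparr>)" "finite_rank 2 (G\<lparr>carrier := A\<rparr>)"
    "g [^] (2::nat) \<in> A" "\<forall>a\<in>A. inv g \<otimes> a \<otimes> g = inv a"
    "finite Q" "comm_group (G\<lparr>carrier := Q\<rparr>)" "odd_order_group (G\<lparr>carrier := Q\<rparr>)"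
    by blast
  interpret E: inversion_extension G A g
    by (intro inversion_extension.intro inversion_extension_axioms.intro group_axioms)
      (use * in \<open>auto simp: conjugate_def\<close>)
  have P: "P = E.P" using *(4) by (simp add: E.generate_eq_P)
  \<comment> \<open>The subgroup \<open>A\<close> inherits this from \<open>P\<close>; it turns
    finite rank into finiteness of the set of elements with trivial square.\<close>
  have "p_group 2 (G\<lparr>carrier := A\<rparr>)"
    using *(5) E.P_subgroup *(3)
    by (auto simp: P p_group_def ord_consistent subgroup.subgroup_is_group E.P_def)
  then have "finite {a \<in> A. a [^] (2::nat) = \<one>}"
    using *(7) finite_rank_iff[OF two_is_prime_nat *(6)] carrier_omega_module_two[OF *(3)] by simp
  then interpret inversion_product G A g Q
    using * assms(4) P by (intro inversion_product.intro inversion_product_axioms.intro E.inversion_extension_axioms) auto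
  show ?L using locally_nilpotent_product FCI_group_product by simp
qed

end
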